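(* Let $\alpha$ and $\beta$ be fixed nonzero integers such that $\gcd(\alpha,\beta)$ is squarefree. For any squarefree positive integer $m$ and real $X>0$, let $$N_m(X;\alpha,\beta) = \#\{(a,b)\in\mathbb{Z}^2\colon |a|\leq X^3,\ |b|\leq X^4,\ m^2\mid \beta a^4 +\alpha b^3\}.$$ Then for any positive real number $M$ and any $\epsilon >0$, $$\sum_{\substack{m>M\\ m\ \mathrm{squarefree}}} N_m(X;\alpha,\beta) = O_\epsilon\left(\frac{X^{7+\epsilon}}{\sqrt{M}}\right) + O_\epsilon(X^{6.992+\epsilon}),$$ where the implied constants depend on $\alpha$, $\beta$ and $\epsilon$ (but not on $M$ or $X$).
   Formalization: Pairs (a,b) with βa⁴ + αb³ = 0 are excluded from N_m(X;α,β); as written, (0,0) is counted for every m, so the sum over squarefree m > M is always infinite. *)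

theory Defs
  imports
    "HOL-Analysis.Infinite_Sum"
    "HOL-Computational_Algebra.Squarefree"
begin

(* Pairs with \<beta> a^4 + \<alpha> b^3 = 0, such as (0,0), are left out: m^2 divides 0 for every m,
   so each of them would contribute 1 to every N_m and make the sum over m > M diverge. *)
definition N_count :: "nat \<Rightarrow> real \<Rightarrow> int \<Rightarrow> int \<Rightarrow> nat" where
  "N_count m X \<alpha> \<beta> =
     card {(a :: int, b :: int). \<bar>of_int a\<bar> \<le> X ^ 3 \<and> \<bar>of_int b\<bar> \<le> X ^ 4 \<and>
             \<beta> * a ^ 4 + \<alpha> * b ^ 3 \<noteq> 0 \<and> (int m)\<^sup>2 dvd \<beta> * a ^ 4 + \<alpha> * b ^ 3}"

end

theory Submission
  imports Defs "HOL-Analysis.Analysis"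
begin

text \<open>
  Up to a divisor bound it suffices to count the pairs $(a,b)$ for which some $m > M$ exists. Put
  $B = \alpha\beta b$ and $c = \alpha\beta^2a^2$, so that $c^2 + B^3$ is a multiple of
  $\beta a^4 + \alpha b^3$. Up to a bounded factor, $m = de$ with $d$ dividing both $a$ and $b$, and
  $e$ coprime to $B$ with $e^2 \mid c^2 + B^3$. Pairs with $d \gg \sqrt M$ number $O(X^7/\sqrt M)$, and
  for $\sqrt M \ll e \le X^{7/2}$ one fixes $a$ and counts the cube roots $b$ modulo $e^2$.

  For $e > X^{7/2}$ let $q \equiv c/B$ modulo $e^2$. The cubic $z^3 + 3Bz - 2c$, evaluated at
  $z = eu + qv$ and made homogeneous with $v$, is $e^2F(u,v)$ for an integral binary cubic form $F$ with
  leading coefficient $e$. Its roots are clustered, and in a reduced basis of the lattice of all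
  $(eu + qv, v)$ the coefficients of $F$ and the coordinates of $(1,0)$ have product
  $O(X^{10}/e)$. These six integers determine $B$ and $c$ as the values at $(1,0)$ of the Hessian and of
  the cubic covariant, so there are $O(X^{6.5+o(1)})$ such pairs, provided that the leading coefficient
  does not vanish. It vanishes only if $z^3 + 3Bz - 2c$ has an integer root, which leaves $O(X^5)$ pairs.
\<close>

section \<open>Covariants of binary cubic forms\<close>

text \<open>
  Coefficients $(p,q,r,s)$ stand for the form $pu^3 + 3qu^2v + 3ruv^2 + sv^3$; \<open>hess\<close> and \<open>jac\<close> are
  its Hessian and its cubic covariant, and \<open>polar\<close> is its symmetric trilinear form.
\<close>


definition hess :: "int \<Rightarrow> int \<Rightarrow> int \<Rightarrow> int \<Rightarrow> int \<Rightarrow> int \<Rightarrow> int" where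
  "hess p q r s x y = (p * r - q\<^sup>2) * x\<^sup>2 + (p * s - q * r) * x * y + (q * s - r\<^sup>2) * y\<^sup>2"

definition jac :: "int \<Rightarrow> int \<Rightarrow> int \<Rightarrow> int \<Rightarrow> int \<Rightarrow> int \<Rightarrow> int" where
  "jac p q r s x y = (3 * p * q * r - 2 * q ^ 3 - p\<^sup>2 * s) * x ^ 3
     + 3 * (2 * p * r\<^sup>2 - q\<^sup>2 * r - p * q * s) * x\<^sup>2 * y
     - 3 * (2 * q\<^sup>2 * s - q * r\<^sup>2 - p * r * s) * x * y\<^sup>2
     - (3 * q * r * s - 2 * r ^ 3 - p * s\<^sup>2) * y ^ 3"

definition polar :: "int \<Rightarrow> int \<Rightarrow> int \<Rightarrow> int \<Rightarrow> int \<times> int \<Rightarrow> int \<times> int \<Rightarrow> int \<times> int \<Rightarrow> int" where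
  "polar p q r s a b c = p * fst a * fst b * fst c
     + q * (fst a * fst b * snd c + fst a * snd b * fst c + snd a * fst b * fst c)
     + r * (fst a * snd b * snd c + snd a * fst b * snd c + snd a * snd b * fst c)
     + s * snd a * snd b * snd c"

text \<open>The primed form is the form with coefficients \<open>(e, q, r, s)\<close> rewritten in
  the basis \<open>(w, y)\<close>, \<open>(z, x)\<close>. There \<open>(x, -y)\<close> represents
  \<open>(w x - y z, 0)\<close>, which is the vector \<open>(1, 0)\<close> when the determinant is
  1. The Hessian has weight 2 and degree 2, hence the fourth power of the determinant.\<close>

lemma hess_unimodular:
  assumes "p' = polar e q r s (w,y) (w,y) (w,y)"
    "q' = polar e q r s (w,y) (w,y) (z,x)"
    "r' = polar e q r s (w,y) (z,x) (z,x)"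
    "s' = polar e q r s (z,x) (z,x) (z,x)"
  shows "hess p' q' r' s' x (-y) = (w * x - y * z)^4 * (e * r - q\<^sup>2)"
  unfolding assms hess_def polar_def fst_conv snd_conv
  by algebra

text \<open>The same covariance, with weight 3 and degree 3.\<close>

lemma jac_unimodular:
  assumes "p' = polar e q r s (w,y) (w,y) (w,y)"
    "q' = polar e q r s (w,y) (w,y) (z,x)"
    "r' = polar e q r s (w,y) (z,x) (z,x)"
    "s' = polar e q r s (z,x) (z,x) (z,x)"
  shows "jac p' q' r' s' x (-y) = (w * x - y * z)^6 * (3 * e * q * r - 2 * q ^ 3 - e\<^sup>2 * s)"
  unfolding assms jac_def polar_def fst_conv snd_conv
  by algebra


section \<open>Reduction to a small form\<close>

text \<open>In a reduced basis twice the mixed term \<open>B\<close> is at most either value of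
  \<open>Q\<close>, so \<open>4 B^2\<close> is at most their product, while the product minus
  \<open>B^2\<close> is the Gram determinant \<open>e^2 L\<close>.\<close>

lemma sl2_reduced_basis:
  fixes e q L :: int
  defines "Q \<equiv> \<lambda>u v. (e * u + q * v)\<^sup>2 + L * v\<^sup>2"
  assumes "L > 0"
  obtains w y z x where "w * x - y * z = 1" "Q w y \<le> Q z x"
    "3 * (Q w y * Q z x) \<le> 4 * (e\<^sup>2 * L)"
proof -
  define B where "B = (\<lambda>w y z x. (e * w + q * y) * (e * z + q * x) + L * y * x)"
  have Q_nonneg: "Q u v \<ge> 0" for u v
    using \<open>L > 0\<close> by (simp add: Q_def)
  \<comment> \<open>A basis minimising the sum of the two values of \<open>Q\<close> is Gauss reduced.\<close>
  define P where "P = (\<lambda>(w, y, z, x). w * x - y * z = (1 :: int))"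
  define f where "f = (\<lambda>(w, y, z, x). nat (Q w y + Q z x))"
  have "P (1, 0, 0, 1)" by (simp add: P_def)
  then obtain t where t: "P t" "\<And>t'. P t' \<Longrightarrow> f t \<le> f t'"
    using ex_has_least_nat[of P _ f] by blast
  obtain w y z x where twyzx: "t = (w, y, z, x)" by (metis prod.exhaust)
  have det: "w * x - y * z = 1" using t(1) by (simp add: P_def twyzx)
  have minimal: "Q w y + Q z x \<le> Q w' y' + Q z' x'" if "w' * x' - y' * z' = 1" for w' y' z' x'
    using t(2)[of "(w', y', z', x')"] that Q_nonneg by (auto simp: P_def f_def twyzx nat_le_eq_zle)
  have expand: "Q (z + k * w) (x + k * y) = Q z x + 2 * k * B w y z x + k\<^sup>2 * Q w y" for k w y z x
    unfolding Q_def B_def by (simp add: power2_eq_square algebra_simps)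
  have Bcomm: "B z x w y = B w y z x" for w y z x by (simp add: B_def algebra_simps)
  \<comment> \<open>Adding a multiple of one basis vector to the other keeps the determinant, so
    minimality applies; \<open>k = 1\<close> and \<open>k = -1\<close> bound \<open>B\<close> from
    both sides.\<close>
  have step1: "0 \<le> 2 * k * B w y z x + k\<^sup>2 * Q w y" for k
  proof -
    have "Q w y + Q z x \<le> Q w y + Q (z + k * w) (x + k * y)"
      using det by (intro minimal) (simp add: algebra_simps)
    thus ?thesis unfolding expand by linarith
  qed
  have B1: "2 * \<bar>B w y z x\<bar> \<le> Q w y"
    using step1[of 1] step1[of "-1"] by simp
  have step2: "0 \<le> 2 * k * B w y z x + k\<^sup>2 * Q z x" for k
  proof -
    have "Q w y + Q z x \<le> Q (w + k * z) (y + k * x) + Q z x"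
      using det by (intro minimal) (simp add: algebra_simps)
    thus ?thesis unfolding expand Bcomm[of z x w y] by linarith
  qed
  have B2: "2 * \<bar>B w y z x\<bar> \<le> Q z x"
    using step2[of 1] step2[of "-1"] by simp
  have "Q w y * Q z x - (B w y z x)\<^sup>2 = (w * x - y * z)\<^sup>2 * (e\<^sup>2 * L)"
    unfolding Q_def B_def by algebra
  hence disc: "Q w y * Q z x = e\<^sup>2 * L + (B w y z x)\<^sup>2" by (simp add: det)
  have "(2 * \<bar>B w y z x\<bar>) * (2 * \<bar>B w y z x\<bar>) \<le> Q w y * Q z x"
    using B1 B2 Q_nonneg by (intro mult_mono) auto
  hence "4 * (B w y z x)\<^sup>2 \<le> Q w y * Q z x"
    by (simp add: power2_eq_square)
  with disc have main: "3 * (Q w y * Q z x) \<le> 4 * (e\<^sup>2 * L)" by linarith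
  show thesis
  proof (cases "Q w y \<le> Q z x")
    case True
    then show ?thesis using that[OF det True main] by blast
  next
    case False
    \<comment> \<open>Exchanging the two vectors needs one change of sign to keep determinant 1, and
      \<open>Q\<close> is even.\<close>
    have "Q (- w) (- y) = Q w y" by (simp add: Q_def power2_eq_square algebra_simps)
    with False that[of z "-y" x "-w"] det main show ?thesis
      by (simp add: algebra_simps)
  qed
qed

text \<open>The fraction \<open>t / v\<close> is a root of the monic cubic
  \<open>z^3 + 3 b z - 2 c\<close>, so in lowest terms its denominator is a unit.\<close>

lemma rational_root_imp_integer_root:
  fixes t v b c :: int
  assumes "v \<noteq> 0" "t ^ 3 + 3 * b * t * v\<^sup>2 - 2 * c * v ^ 3 = 0"
  obtains z where "z ^ 3 + 3 * b * z = 2 * c"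
proof -
  define g where "g = gcd t v"
  have g: "g \<noteq> 0" using assms(1) by (simp add: g_def)
  obtain t' v' where tv: "t = t' * g" "v = v' * g" "coprime t' v'"
    using gcd_coprime_exists[of t v] g unfolding g_def by metis
  have "g ^ 3 * (t' ^ 3 + 3 * b * t' * v'\<^sup>2 - 2 * c * v' ^ 3) = 0"
    using assms(2) unfolding tv by (simp add: power2_eq_square power3_eq_cube algebra_simps)
  hence eq: "t' ^ 3 + 3 * b * t' * v'\<^sup>2 - 2 * c * v' ^ 3 = 0" using g by simp
  have "v' dvd t' ^ 3"
  proof -
    have "t' ^ 3 = v' * (2 * c * v'\<^sup>2 - 3 * b * t' * v')"
      using eq by (simp add: power2_eq_square power3_eq_cube algebra_simps)
    thus ?thesis by simp
  qed
  moreover have "coprime v' (t' ^ 3)" using tv(3) by (simp add: coprime_commute)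
  ultimately have "is_unit v'" by (meson coprime_absorb_left coprime_commute)
  hence "v' = 1 \<or> v' = -1" by auto
  hence "v' * v' = 1" by auto
  have "(t' * v') ^ 3 + 3 * b * (t' * v') = (v' * v') * (v' * t' ^ 3) + 3 * b * (t' * v')"
    by (simp add: power3_eq_cube algebra_simps)
  also have "\<dots> = v' * (t' ^ 3 + 3 * b * t' * v'\<^sup>2)"
    by (simp add: \<open>v' * v' = 1\<close> power2_eq_square algebra_simps)
  also have "\<dots> = 2 * c * (v' * v') * (v' * v')"
    using eq by (simp add: power3_eq_cube algebra_simps)
  also have "\<dots> = 2 * c" using \<open>v' * v' = 1\<close> by simp
  finally show thesis by (rule that)
qed


section \<open>Size estimates and the small form\<close>

text \<open>The clamp at 1 keeps a vanishing entry from hiding the size of the others in a product,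
  and it makes negative powers meaningful at 0.\<close>

definition hat :: "int \<Rightarrow> real" where
  "hat n = max 1 \<bar>of_int n\<bar>"

lemma hat_ge_1: "hat n \<ge> 1"
  by (simp add: hat_def)

text \<open>Completing the cube: with \<open>t = e u + q v\<close> the form times \<open>e^2\<close>
  loses its term in \<open>t^2 v\<close> and becomes \<open>t^3 + 3 b t v^2 - 2 c v^3\<close>. This
  is the polarised identity.\<close>

lemma polar_depressed:
  fixes e q r s b c :: int
  assumes "e * r = q\<^sup>2 + b" "e\<^sup>2 * s = q ^ 3 + 3 * q * b - 2 * c"
    "t1 = e * u1 + q * v1" "t2 = e * u2 + q * v2" "t3 = e * u3 + q * v3"
  shows "e\<^sup>2 * polar e q r s (u1, v1) (u2, v2) (u3, v3)
    = t1 * t2 * t3 + b * (t1 * v2 * v3 + v1 * t2 * v3 + v1 * v2 * t3) - 2 * c * (v1 * v2 * v3)"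
proof -
  have s: "2 * c = q ^ 3 + 3 * q * b - e\<^sup>2 * s" and b: "b = e * r - q\<^sup>2"
    using assms(1,2) by auto
  show ?thesis unfolding assms(3-5) polar_def fst_conv snd_conv s b by algebra
qed

text \<open>The scaling is homogeneous: each \<open>v\<close> is smaller than its \<open>t\<close>
  by \<open>Y^2\<close>, which the sizes \<open>Y^4\<close> of \<open>b\<close> and
  \<open>Y^6\<close> of \<open>c\<close> make up for. Every monomial is at most
  \<open>g1 g2 g3\<close>, and the coefficients 1 + 3 + 2 add up to 6.\<close>

lemma trilinear_bound:
  fixes t1 t2 t3 v1 v2 v3 b c Y g1 g2 g3 :: real
  assumes "Y > 0" "\<bar>b\<bar> \<le> Y ^ 4" "\<bar>c\<bar> \<le> Y ^ 6"
    and t: "\<bar>t1\<bar> \<le> g1" "\<bar>t2\<bar> \<le> g2" "\<bar>t3\<bar> \<le> g3"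
    and v: "\<bar>v1\<bar> \<le> g1 / Y\<^sup>2" "\<bar>v2\<bar> \<le> g2 / Y\<^sup>2" "\<bar>v3\<bar> \<le> g3 / Y\<^sup>2"
  shows "\<bar>t1 * t2 * t3 + b * (t1 * v2 * v3 + v1 * t2 * v3 + v1 * v2 * t3) - 2 * c * (v1 * v2 * v3)\<bar>
    \<le> 6 * (g1 * g2 * g3)"
proof -
  have g: "g1 \<ge> 0" "g2 \<ge> 0" "g3 \<ge> 0" using t by linarith+
  have prod_bound: "\<bar>k * (x * y * z)\<bar> \<le> K * (A * B * D)"
    if "\<bar>k\<bar> \<le> K" "\<bar>x\<bar> \<le> A" "\<bar>y\<bar> \<le> B" "\<bar>z\<bar> \<le> D" for k x y z K A B D :: real
    unfolding abs_mult using that by (intro mult_mono mult_nonneg_nonneg) (auto intro: order_trans[OF abs_ge_zero])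
  have 0: "\<bar>1 * (t1 * t2 * t3)\<bar> \<le> 1 * (g1 * g2 * g3)"
    using t by (intro prod_bound) auto
  have 1: "\<bar>b * (t1 * v2 * v3)\<bar> \<le> Y ^ 4 * (g1 * (g2 / Y\<^sup>2) * (g3 / Y\<^sup>2))"
    using assms by (intro prod_bound) auto
  have 2: "\<bar>b * (v1 * t2 * v3)\<bar> \<le> Y ^ 4 * ((g1 / Y\<^sup>2) * g2 * (g3 / Y\<^sup>2))"
    using assms by (intro prod_bound) auto
  have 3: "\<bar>b * (v1 * v2 * t3)\<bar> \<le> Y ^ 4 * ((g1 / Y\<^sup>2) * (g2 / Y\<^sup>2) * g3)"
    using assms by (intro prod_bound) auto
  have 4: "\<bar>c * (v1 * v2 * v3)\<bar> \<le> Y ^ 6 * ((g1 / Y\<^sup>2) * (g2 / Y\<^sup>2) * (g3 / Y\<^sup>2))"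
    using assms by (intro prod_bound) auto
  have Y: "Y ^ 4 = Y\<^sup>2 * Y\<^sup>2" "Y ^ 6 = Y\<^sup>2 * Y\<^sup>2 * Y\<^sup>2" by (simp_all flip: power_add)
  have "Y ^ 4 * (g1 * (g2 / Y\<^sup>2) * (g3 / Y\<^sup>2)) = g1 * g2 * g3"
    "Y ^ 4 * ((g1 / Y\<^sup>2) * g2 * (g3 / Y\<^sup>2)) = g1 * g2 * g3"
    "Y ^ 4 * ((g1 / Y\<^sup>2) * (g2 / Y\<^sup>2) * g3) = g1 * g2 * g3"
    "Y ^ 6 * ((g1 / Y\<^sup>2) * (g2 / Y\<^sup>2) * (g3 / Y\<^sup>2)) = g1 * g2 * g3"
    using \<open>Y > 0\<close> unfolding Y by simp_all
  with 0 1 2 3 4 show ?thesis by (simp add: algebra_simps abs_le_iff)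
qed

text \<open>The form with leading coefficient \<open>e\<close> has \<open>b\<close> and
  \<open>2 c\<close> as values of its Hessian and cubic covariant at \<open>(1, 0)\<close>, and both
  values survive a change to a reduced basis. The product of the six bounds depends on the lengths
  \<open>g1\<close>, \<open>g2\<close> of the basis vectors only through \<open>g1 g2\<close>, so it
  does not matter how skew the reduced basis is.\<close>

lemma small_form_representation:
  fixes b c e Y :: int
  assumes "Y \<ge> 1" "e \<ge> Y\<^sup>2" "coprime e b" "e\<^sup>2 dvd c\<^sup>2 + b ^ 3"
    and b: "\<bar>b\<bar> \<le> Y ^ 4" and c: "\<bar>c\<bar> \<le> Y ^ 6"
    and no_root: "\<And>z. z ^ 3 + 3 * b * z \<noteq> 2 * c"
  obtains p q r s x y where
    "hat p * hat q * hat r * hat s * hat x * hat y * e \<le> 165888 * of_int Y ^ 10"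
    "b = hess p q r s x y" "2 * c = jac p q r s x y"
proof -
  have e: "e > 0" using assms(1,2) by (smt (verit) zero_less_power)
  have cop: "coprime (e\<^sup>2) b" using assms(3) by simp
  then obtain i j where ij: "i * e\<^sup>2 + j * b = 1"
    by (metis bezout_int coprime_iff_gcd_eq_1)
  \<comment> \<open>\<open>j\<close> inverts \<open>b\<close> modulo \<open>e^2\<close>, so
    \<open>q\<close> is \<open>c / b\<close> there.\<close>
  define q where "q = j * c"
  have qb: "e\<^sup>2 dvd q * b - c"
  proof
    have "q * b - c = (j * b - 1) * c" by (simp add: q_def algebra_simps)
    also have "j * b - 1 = - (i * e\<^sup>2)" using ij by simp
    finally show "q * b - c = e\<^sup>2 * (- i * c)" by simp
  qed
  \<comment> \<open>As \<open>c\<close> is \<open>q b\<close> modulo \<open>e^2\<close>, the sum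
    \<open>c^2 + b^3\<close> becomes \<open>b^2 (q^2 + b)\<close>, and the unit \<open>b^2\<close>
    cancels.\<close>
  have "e\<^sup>2 dvd (q * b - c) * (q * b + c) + (c\<^sup>2 + b ^ 3)"
    using qb assms(4) by simp
  also have "(q * b - c) * (q * b + c) + (c\<^sup>2 + b ^ 3) = b\<^sup>2 * (q\<^sup>2 + b)"
    by (simp add: power2_eq_square power3_eq_cube algebra_simps)
  finally have q2: "e\<^sup>2 dvd q\<^sup>2 + b"
    using cop by (simp add: coprime_dvd_mult_right_iff)
  hence "e dvd q\<^sup>2 + b" by (metis dvd_power dvd_trans zero_less_numeral)
  then obtain r where r: "e * r = q\<^sup>2 + b" by (metis dvdE)
  \<comment> \<open>So \<open>q\<close> is a root of \<open>z^3 + 3 b z - 2 c\<close> modulo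
    \<open>e^2\<close>, and also of its derivative \<open>3 (z^2 + b)\<close>; this double root
    makes the form integral.\<close>
  have "e\<^sup>2 dvd q * (q\<^sup>2 + b) + 2 * (q * b - c)" by (rule dvd_add[OF dvd_mult[OF q2] dvd_mult[OF qb]])
  moreover have "q * (q\<^sup>2 + b) + 2 * (q * b - c) = q ^ 3 + 3 * q * b - 2 * c"
    by (simp add: power2_eq_square power3_eq_cube algebra_simps)
  ultimately obtain s where s: "e\<^sup>2 * s = q ^ 3 + 3 * q * b - 2 * c" by (metis dvdE)
  \<comment> \<open>\<open>Q\<close> measures \<open>e u + q v\<close> together with
    \<open>Y^2 v\<close>, the scaling under which all terms of the cubic have equal weight.\<close>
  define Q where "Q = (\<lambda>u v. (e * u + q * v)\<^sup>2 + Y ^ 4 * v\<^sup>2)"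
  obtain w y z x where det: "w * x - y * z = 1" and Q12: "Q w y \<le> Q z x"
    and Qprod: "3 * (Q w y * Q z x) \<le> 4 * (e\<^sup>2 * Y ^ 4)"
    using sl2_reduced_basis[of "Y ^ 4" e q] \<open>Y \<ge> 1\<close> unfolding Q_def by (metis zero_less_power int_one_le_iff_zero_less)
  define t1 t2 where "t1 = e * w + q * y" and "t2 = e * z + q * x"
  define g1 g2 where "g1 = sqrt (of_int (Q w y))" and "g2 = sqrt (of_int (Q z x))"
  define y' where "y' = (of_int Y :: real)"
  have y': "y' \<ge> 1" using assms(1) by (simp add: y'_def)
  \<comment> \<open>For \<open>v = 0\<close> this rests on \<open>Y^2 \<le> e\<close>. It makes the
    bounds for the two coordinates at least 1, so that they hold for \<open>hat\<close> too.\<close>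
  have Qge: "Q u v \<ge> Y ^ 4" if "u \<noteq> 0 \<or> v \<noteq> 0" for u v
  proof (cases "v = 0")
    case True
    have "(Y\<^sup>2)\<^sup>2 * 1 \<le> e\<^sup>2 * u\<^sup>2"
      using assms(1,2) True that by (intro mult_mono power_mono) (auto simp: Suc_le_eq int_one_le_iff_zero_less)
    thus ?thesis using True by (simp add: Q_def power_mult_distrib flip: power_mult)
  next
    case False
    hence "v\<^sup>2 \<ge> 1" by (simp add: int_one_le_iff_zero_less)
    hence "Y ^ 4 * 1 \<le> Y ^ 4 * v\<^sup>2" using assms(1) by (intro mult_left_mono) auto
    thus ?thesis using zero_le_power2[of "e * u + q * v"] unfolding Q_def by linarith
  qed
  have Qnn: "Q u v \<ge> 0" for u v using assms(1) by (simp add: Q_def)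
  have sqrtY: "sqrt (of_int (Y ^ 4)) = y'\<^sup>2"
    using y' by (simp add: y'_def real_sqrt_unique flip: power_mult)
  have "Q w y \<ge> Y ^ 4" "Q z x \<ge> Y ^ 4"
    using det by (intro Qge; auto)+
  hence gY: "g1 \<ge> y'\<^sup>2" "g2 \<ge> y'\<^sup>2"
    unfolding g1_def g2_def sqrtY[symmetric] by (simp_all only: real_sqrt_le_iff of_int_le_iff)
  have g12: "g1 \<le> g2" using Q12 by (simp add: g1_def g2_def)
  have y'2: "y'\<^sup>2 \<ge> 1" using y' by simp
  have bounds: "\<bar>of_int (e * u + q * v)\<bar> \<le> sqrt (of_int (Q u v))"
    "\<bar>of_int v\<bar> \<le> sqrt (of_int (Q u v)) / y'\<^sup>2" for u v
  proof -
    have "(of_int (e * u + q * v))\<^sup>2 \<le> (of_int (Q u v) :: real)"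
      "of_int (Y ^ 4 * v\<^sup>2) \<le> (of_int (Q u v) :: real)"
      using assms(1) by (simp_all add: Q_def)
    hence "\<bar>of_int (e * u + q * v)\<bar> \<le> sqrt (of_int (Q u v))"
      "sqrt (of_int (Y ^ 4 * v\<^sup>2)) \<le> sqrt (of_int (Q u v))"
      using real_le_rsqrt by (auto simp: abs_le_square_iff real_le_rsqrt simp flip: real_sqrt_abs)
    moreover have "sqrt (of_int (Y ^ 4 * v\<^sup>2)) = y'\<^sup>2 * \<bar>of_int v\<bar>"
      using sqrtY by (simp add: real_sqrt_mult)
    ultimately have "\<bar>of_int (e * u + q * v)\<bar> \<le> sqrt (of_int (Q u v))"
      "\<bar>of_int v\<bar> * y'\<^sup>2 \<le> sqrt (of_int (Q u v))"
      by (simp_all only: mult.commute)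
    thus "\<bar>of_int (e * u + q * v)\<bar> \<le> sqrt (of_int (Q u v))"
      "\<bar>of_int v\<bar> \<le> sqrt (of_int (Q u v)) / y'\<^sup>2"
      using y'2 by (simp_all only: pos_le_divide_eq[of "y'\<^sup>2"])
  qed
  define F where "F = polar e q r s"
  have Fbound: "\<bar>of_int (F (u1, v1) (u2, v2) (u3, v3))\<bar> \<le> 6 * (h1 * h2 * h3) / (of_int e)\<^sup>2"
    if "h1 = sqrt (of_int (Q u1 v1))" "h2 = sqrt (of_int (Q u2 v2))" "h3 = sqrt (of_int (Q u3 v3))"
    for u1 v1 u2 v2 u3 v3 h1 h2 h3
  proof -
    have "of_int (e\<^sup>2 * F (u1, v1) (u2, v2) (u3, v3)) =
      (of_int (e * u1 + q * v1) * of_int (e * u2 + q * v2) * of_int (e * u3 + q * v3)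
       + of_int b * (of_int (e * u1 + q * v1) * of_int v2 * of_int v3
          + of_int v1 * of_int (e * u2 + q * v2) * of_int v3
          + of_int v1 * of_int v2 * of_int (e * u3 + q * v3))
       - 2 * of_int c * (of_int v1 * of_int v2 * of_int v3) :: real)"
      unfolding F_def polar_depressed[OF r s refl refl refl]
      by simp
    also have "\<bar>\<dots>\<bar> \<le> 6 * (h1 * h2 * h3)"
    proof (rule trilinear_bound[of y'])
      show "\<bar>of_int b\<bar> \<le> y' ^ 4" "\<bar>of_int c\<bar> \<le> y' ^ 6"
        using b c unfolding y'_def by (metis of_int_abs of_int_le_iff of_int_power)+
    qed (use y' bounds that in auto)
    finally show ?thesis using e by (simp add: abs_mult field_simps)
  qed
  define p' q' r' s' where "p' = F (w, y) (w, y) (w, y)" and "q' = F (w, y) (w, y) (z, x)"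
    and "r' = F (w, y) (z, x) (z, x)" and "s' = F (z, x) (z, x) (z, x)"
  \<comment> \<open>Otherwise \<open>t1 / y\<close> would be a rational root of the cubic; for
    \<open>y = 0\<close> the equation forces \<open>w = 0\<close>, against determinant 1.\<close>
  have "p' \<noteq> 0"
  proof
    assume "p' = 0"
    hence eq: "t1 ^ 3 + 3 * b * t1 * y\<^sup>2 - 2 * c * y ^ 3 = 0"
      using polar_depressed[OF r s refl refl refl, of w y w y w y]
      unfolding p'_def F_def t1_def by (simp add: power2_eq_square power3_eq_cube algebra_simps)
    show False
    proof (cases "y = 0")
      case True
      hence "t1 = 0" using eq by simp
      with True e det show False by (simp add: t1_def)
    next
      case False
      with eq no_root show False by (metis rational_root_imp_integer_root)
    qed
  qed
  define P where "P = 6 * g1 ^ 3 / (of_int e)\<^sup>2"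
  \<comment> \<open>The bounds \<open>P, P k, P k\<^sup>2, P k\<^sup>3\<close> of the coefficients are all at least \<open>\<bar>p'\<bar> \<ge> 1\<close>,
    so they bound \<open>hat\<close> as well.\<close>
  define k where "k = g2 / g1"
  have g1pos: "g1 > 0" using gY y'2 by linarith
  have k: "k \<ge> 1" using g12 g1pos by (simp add: k_def)
  have g2: "g2 = k * g1" using g1pos by (simp add: k_def)
  have pb: "\<bar>of_int p'\<bar> \<le> P" "\<bar>of_int q'\<bar> \<le> P * k" "\<bar>of_int r'\<bar> \<le> P * k\<^sup>2" "\<bar>of_int s'\<bar> \<le> P * k ^ 3"
    using Fbound[of g1 w y g1 w y g1 w y] Fbound[of g1 w y g1 w y g2 z x]
      Fbound[of g1 w y g2 z x g2 z x] Fbound[of g2 z x g2 z x g2 z x]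
    unfolding p'_def q'_def r'_def s'_def P_def g1_def[symmetric] g2_def[symmetric] g2
    by (simp_all add: power2_eq_square power3_eq_cube mult_ac)
  have "P \<ge> 1" using \<open>p' \<noteq> 0\<close> pb(1) by linarith
  have Pk: "P * k ^ n \<ge> 1" for n
    using mult_mono[of 1 P 1 "k ^ n"] \<open>P \<ge> 1\<close> k by simp
  have h: "hat p' \<le> P" "hat q' \<le> P * k" "hat r' \<le> P * k\<^sup>2" "hat s' \<le> P * k ^ 3"
    using pb \<open>P \<ge> 1\<close> Pk[of 1] Pk[of 2] Pk[of 3] by (simp_all add: hat_def)
  have "1 \<le> g2 / y'\<^sup>2" "1 \<le> g1 / y'\<^sup>2"
    using gY y'2 by (simp_all only: pos_le_divide_eq[of "y'\<^sup>2"])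
  hence hx: "hat x \<le> g2 / y'\<^sup>2" "hat (- y) \<le> g1 / y'\<^sup>2"
    using bounds(2)[of x z] bounds(2)[of y w]
    by (simp_all add: hat_def flip: g1_def g2_def)
  define G where "G = g1 * g2"
  \<comment> \<open>The factor 3 of the reduction inequality is dropped, so that the right-hand side
    is a perfect square.\<close>
  have G: "G \<le> 2 * of_int e * y'\<^sup>2"
  proof (rule power2_le_imp_le)
    have "G\<^sup>2 = of_int (Q w y * Q z x)"
      using \<open>Q w y \<ge> Y ^ 4\<close> Q12 assms(1)
      by (simp add: G_def g1_def g2_def power_mult_distrib Qnn)
    also have "\<dots> \<le> of_int (4 * (e\<^sup>2 * Y ^ 4))"
      using Qprod \<open>Q w y \<ge> Y ^ 4\<close> \<open>Q z x \<ge> Y ^ 4\<close> assms(1) unfolding of_int_le_iff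
      by (smt (verit, best) mult_nonneg_nonneg zero_le_power)
    also have "\<dots> = (2 * of_int e * y'\<^sup>2)\<^sup>2"
      by (simp add: y'_def power_mult_distrib flip: power_mult)
    finally show "G\<^sup>2 \<le> (2 * of_int e * y'\<^sup>2)\<^sup>2" .
  qed (use e in auto)
  have "hat p' * hat q' * hat r' * hat s' * hat x * hat (- y) * e
      \<le> P * (P * k) * (P * k\<^sup>2) * (P * k ^ 3) * (g2 / y'\<^sup>2) * (g1 / y'\<^sup>2) * e"
    using h hx e \<open>P \<ge> 1\<close> k g1pos g2
    by (intro mult_mono mult_nonneg_nonneg) (auto intro: order_trans[OF _ hat_ge_1])
  \<comment> \<open>The powers of \<open>k\<close> add up to 6, and \<open>P^4 k^6\<close> is
    \<open>6^4 (g1 g2)^6 / e^8\<close>. Inserting the bound for \<open>G\<close> gives the constant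
    \<open>165888 = 6^4 2^7\<close>.\<close>
  also have "\<dots> = 1296 * G ^ 7 / (of_int e ^ 7 * y' ^ 4)"
    using e y' unfolding P_def G_def g2 by (simp add: field_simps power_numeral_reduce)
  also have "\<dots> \<le> 1296 * (2 * of_int e * y'\<^sup>2) ^ 7 / (of_int e ^ 7 * y' ^ 4)"
    using e y' G g1pos g2 k by (intro divide_right_mono mult_left_mono power_mono) (auto simp: G_def)
  also have "\<dots> = 165888 * y' ^ 10"
    using e y' by (simp add: field_simps flip: power_add power_mult)
  finally have size: "hat p' * hat q' * hat r' * hat s' * hat x * hat (- y) * e \<le> 165888 * of_int Y ^ 10"
    by (simp add: y'_def)
  have "b = hess p' q' r' s' x (- y)"
    using hess_unimodular[OF p'_def[unfolded F_def] q'_def[unfolded F_def] r'_def[unfolded F_def] s'_def[unfolded F_def]] det r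
    by simp
  moreover have "2 * c = jac p' q' r' s' x (- y)"
  proof -
    have "3 * e * q * r = 3 * q * (q\<^sup>2 + b)" using r by (simp add: mult_ac)
    hence "3 * e * q * r - 2 * q ^ 3 - e\<^sup>2 * s = 2 * c"
      using s by (simp add: power2_eq_square power3_eq_cube algebra_simps)
    thus ?thesis
      using jac_unimodular[OF p'_def[unfolded F_def] q'_def[unfolded F_def] r'_def[unfolded F_def] s'_def[unfolded F_def]] det
      by simp
  qed
  ultimately show thesis using size that by blast
qed


section \<open>Counting\<close>

text \<open>Rankin's trick.\<close>

lemma card_bounded_product_lists:
  fixes h :: "'a \<Rightarrow> real" and \<sigma> B Z :: real
  assumes "\<sigma> > 0" "B \<ge> 0" "\<And>x. h x \<ge> 1"
    and fin: "finite {x. h x \<le> B}"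
    and Z: "\<And>A. finite A \<Longrightarrow> (\<Sum>x\<in>A. h x powr - \<sigma>) \<le> Z"
  shows "finite {xs. length xs = k \<and> prod_list (map h xs) \<le> B}"
    "real (card {xs. length xs = k \<and> prod_list (map h xs) \<le> B}) \<le> Z ^ k * B powr \<sigma>"
proof -
  define L where "L = (\<lambda>k. {xs. length xs = k \<and> prod_list (map h xs) \<le> B})"
  define A where "A = {x. h x \<le> B}"
  define U where "U = (\<lambda>k. {xs. set xs \<subseteq> A \<and> length xs = k})"
  have prod_ge: "prod_list (map h xs) \<ge> 1" for xs
  proof (induction xs)
    case (Cons x xs)
    then show ?case using mult_mono[of 1 "h x" 1 "prod_list (map h xs)"] assms(3)[of x] by simp
  qed simp
  have elem: "h x \<le> prod_list (map h xs)" if "x \<in> set xs" for x xs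
    using that
  proof (induction xs)
    case (Cons y ys)
    have "h x \<le> h y * prod_list (map h ys)"
    proof (cases "x = y")
      case True
      then show ?thesis using mult_mono[of "h x" "h y" 1 "prod_list (map h ys)"] prod_ge[of ys] assms(3)[of x] by simp
    next
      case False
      with Cons have "h x \<le> prod_list (map h ys)" by simp
      thus ?thesis using mult_mono[of 1 "h y" "h x" "prod_list (map h ys)"] assms(3)[of x] assms(3)[of y] by simp
    qed
    thus ?case by simp
  qed simp
  have finU: "finite (U k)" for k
    unfolding U_def using fin by (intro finite_lists_length_eq) (simp add: A_def)
  \<comment> \<open>All factors are at least 1, so each entry obeys the bound imposed on the
    product. The lists lie in a finite box, over which the weighted sum factorises.\<close>
  have LU: "L k \<subseteq> U k" for k
    unfolding L_def U_def A_def using elem by (auto intro: order_trans)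
  have sumU: "(\<Sum>xs\<in>U k. prod_list (map (\<lambda>x. h x powr - \<sigma>) xs)) = (\<Sum>x\<in>A. h x powr - \<sigma>) ^ k" for k
  proof (induction k)
    case 0
    have "U 0 = {[]}" by (auto simp: U_def)
    thus ?case by simp
  next
    case (Suc k)
    have "U (Suc k) = (\<lambda>(x, xs). x # xs) ` (A \<times> U k)"
      by (auto simp: U_def length_Suc_conv image_iff)
    moreover have "inj_on (\<lambda>(x, xs). x # xs) (A \<times> U k)" by (auto simp: inj_on_def)
    ultimately have "(\<Sum>xs\<in>U (Suc k). prod_list (map (\<lambda>x. h x powr - \<sigma>) xs))
       = (\<Sum>(x, xs)\<in>A \<times> U k. h x powr - \<sigma> * prod_list (map (\<lambda>x. h x powr - \<sigma>) xs))"
      by (simp add: sum.reindex case_prod_unfold o_def)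
    also have "\<dots> = (\<Sum>x\<in>A. h x powr - \<sigma>) * (\<Sum>xs\<in>U k. prod_list (map (\<lambda>x. h x powr - \<sigma>) xs))"
      by (simp add: sum_product sum.cartesian_product)
    finally show ?case using Suc by simp
  qed
  have powr_prod: "prod_list (map (\<lambda>x. h x powr - \<sigma>) xs) = prod_list (map h xs) powr - \<sigma>" for xs
  proof (induction xs)
    case (Cons x xs)
    thus ?case using assms(3)[of x] prod_ge[of xs] by (simp add: powr_mult)
  qed simp
  show "finite {xs. length xs = k \<and> prod_list (map h xs) \<le> B}"
    using LU finU finite_subset unfolding L_def by blast
  have "real (card (L k)) = (\<Sum>xs\<in>L k. 1)" by simp
  \<comment> \<open>On \<open>L k\<close> the quotient of \<open>B\<close> by the product is at
    least 1, and so is its power; the sum may then be extended to \<open>U k\<close>.\<close>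
  also have "\<dots> \<le> (\<Sum>xs\<in>L k. B powr \<sigma> * prod_list (map (\<lambda>x. h x powr - \<sigma>) xs))"
  proof (rule sum_mono)
    fix xs assume "xs \<in> L k"
    hence "prod_list (map h xs) powr \<sigma> \<le> B powr \<sigma>"
      using prod_ge[of xs] assms(1) by (intro powr_mono2) (auto simp: L_def)
    thus "1 \<le> B powr \<sigma> * prod_list (map (\<lambda>x. h x powr - \<sigma>) xs)"
      unfolding powr_prod using prod_ge[of xs] by (simp add: powr_minus field_simps)
  qed
  also have "\<dots> = B powr \<sigma> * (\<Sum>xs\<in>L k. prod_list (map (\<lambda>x. h x powr - \<sigma>) xs))"
    by (simp add: sum_distrib_left)
  also have "\<dots> \<le> B powr \<sigma> * (\<Sum>xs\<in>U k. prod_list (map (\<lambda>x. h x powr - \<sigma>) xs))"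
    using LU finU by (intro mult_left_mono sum_mono2) (auto simp: powr_prod)
  also have "\<dots> \<le> B powr \<sigma> * Z ^ k"
    unfolding sumU using Z[of A] fin by (intro mult_left_mono power_mono) (auto simp: A_def intro: sum_nonneg)
  finally show "real (card {xs. length xs = k \<and> prod_list (map h xs) \<le> B}) \<le> Z ^ k * B powr \<sigma>"
    by (simp add: L_def mult.commute)
qed

section \<open>Tails of inverse squares and the divisor bound\<close>

text \<open>Comparison with the telescoping series of \<open>2 / (d (d + 1))\<close>, where the
  factor 2 makes the comparison valid from \<open>d = 1\<close> on.\<close>

lemma sum_tail_inverse_squares:
  fixes D :: real and A :: "nat set"
  assumes "finite A" "\<And>d. d \<in> A \<Longrightarrow> real d > D" "D > 0"
  shows "(\<Sum>d\<in>A. 1 / real d ^ 2) \<le> 2 / D"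
proof -
  define n where "n = nat \<lfloor>D\<rfloor> + 1"
  have n: "real n > D" "n > 0" unfolding n_def using assms(3) by linarith+
  obtain N where N: "A \<subseteq> {..<N}" "n \<le> N"
    using assms(1) by (metis finite_nat_iff_bounded le_add1 le_add2 lessThan_subset_iff order_trans)
  have "A \<subseteq> {n..<N}"
  proof
    fix d assume d: "d \<in> A"
    hence "real d > D" using assms by blast
    hence "d \<ge> n" unfolding n_def using assms(3) by linarith
    thus "d \<in> {n..<N}" using N d by auto
  qed
  hence "(\<Sum>d\<in>A. 1 / real d ^ 2) \<le> (\<Sum>d\<in>{n..<N}. 1 / real d ^ 2)"
    by (intro sum_mono2) auto
  also have "\<dots> \<le> (\<Sum>d\<in>{n..<N}. 2 / real d - 2 / real (Suc d))"
  proof (rule sum_mono)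
    fix d assume "d \<in> {n..<N}"
    hence d: "real d \<ge> 1" using n(2) by auto
    have "1 / real d ^ 2 = 2 / (real d * (2 * real d))" by (simp add: power2_eq_square)
    also have "\<dots> \<le> 2 / (real d * real (Suc d))"
      using d by (intro divide_left_mono mult_left_mono) auto
    also have "\<dots> = 2 / real d - 2 / real (Suc d)"
      using d by (simp add: field_simps)
    finally show "1 / real d ^ 2 \<le> 2 / real d - 2 / real (Suc d)" .
  qed
  also have "\<dots> = 2 / real n - 2 / real N"
    using sum_Suc_diff'[of n N "\<lambda>d. - 2 / real d"] N(2) by simp
  also have "\<dots> \<le> 2 / real n" by simp
  also have "\<dots> \<le> 2 / D" using n assms(3) by (simp add: frac_le)
  finally show ?thesis .
qed

text \<open>Squarefree divisors correspond to sets of primes dividing \<open>n\<close>. Primes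
  beyond \<open>T\<close> satisfy \<open>p powr \<delta> \<ge> 2\<close> and are charged to
  \<open>n powr \<delta>\<close>; the others, at most \<open>T + 1\<close> in number, cost a
  constant.\<close>

lemma card_squarefree_divisors_le:
  fixes \<delta> :: real
  assumes "\<delta> > 0"
  obtains C where "C > 0"
    "\<And>n :: nat. n > 0 \<Longrightarrow> real (card {d. squarefree d \<and> d dvd n}) \<le> C * real n powr \<delta>"
proof
  define T where "T = nat \<lceil>2 powr (1 / \<delta>)\<rceil>"
  show "(2 :: real) ^ Suc T > 0" by simp
  fix n :: nat assume n: "n > 0"
  define P where "P = prime_factors n"
  have finP: "finite P" by (simp add: P_def)
  have prP: "prime p" if "p \<in> P" for p using that by (auto simp: P_def)
  have "inj_on prime_factors {d. squarefree d \<and> d dvd n}"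
  proof (rule inj_onI)
    have pr: "\<Prod>(prime_factors d) = d" if "squarefree d" for d :: nat
    proof -
      have "d \<noteq> 0" using that by (metis not_squarefree_0)
      hence "d = (\<Prod>p\<in>prime_factors d. p ^ multiplicity p d)"
        using prod_prime_factors[of d] by simp
      also have "\<dots> = \<Prod>(prime_factors d)"
        using that \<open>d \<noteq> 0\<close> squarefree_factorial_semiring'[of d] by (intro prod.cong) auto
      finally show ?thesis ..
    qed
    fix c d assume "c \<in> {d. squarefree d \<and> d dvd n}" "d \<in> {d. squarefree d \<and> d dvd n}"
      "prime_factors c = prime_factors d"
    thus "c = d" using pr by (metis mem_Collect_eq)
  qed
  moreover have "prime_factors ` {d. squarefree d \<and> d dvd n} \<subseteq> Pow P"
    using n by (auto simp: P_def dvd_prime_factors dest!: dvd_prime_factors[rotated])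
  ultimately have "card {d. squarefree d \<and> d dvd n} \<le> card (Pow P)"
    using finP by (intro card_inj_on_le[of prime_factors]) auto
  hence "real (card {d. squarefree d \<and> d dvd n}) \<le> 2 ^ card P"
    using finP by (simp add: card_Pow flip: of_nat_le_iff)
  also have "card P = card (P \<inter> {..T}) + card (P - {..T})"
    using finP by (metis card_Int_Diff)
  also have "(2 :: real) ^ \<dots> = 2 ^ card (P \<inter> {..T}) * 2 ^ card (P - {..T})"
    by (rule power_add)
  also have "\<dots> \<le> 2 ^ Suc T * real n powr \<delta>"
  proof (intro mult_mono)
    have "card (P \<inter> {..T}) \<le> card {..T}" by (intro card_mono) auto
    thus "(2 :: real) ^ card (P \<inter> {..T}) \<le> 2 ^ Suc T" by (intro power_increasing) auto
    have "(2 :: real) ^ card (P - {..T}) = (\<Prod>p\<in>P - {..T}. 2)" by simp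
    also have "\<dots> \<le> (\<Prod>p\<in>P - {..T}. real p powr \<delta>)"
    proof (rule prod_mono)
      fix p assume "p \<in> P - {..T}"
      hence "real p \<ge> 2 powr (1 / \<delta>)" unfolding T_def by (simp; linarith)
      hence "real p powr \<delta> \<ge> (2 powr (1 / \<delta>)) powr \<delta>" using assms by (intro powr_mono2) auto
      thus "0 \<le> (2 :: real) \<and> 2 \<le> real p powr \<delta>" using assms by (simp add: powr_powr)
    qed
    also have "\<dots> = real (\<Prod>p\<in>P - {..T}. p) powr \<delta>"
      by (simp add: prod_powr_distrib)
    also have "\<dots> \<le> real n powr \<delta>"
    proof (intro powr_mono2)
      have "\<Prod>P dvd n"
      proof -
        have "(\<Prod>p\<in>P. p) dvd (\<Prod>p\<in>P. p ^ multiplicity p n)"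
          unfolding P_def by (intro prod_dvd_prod dvd_power) (auto simp: prime_factors_multiplicity)
        thus ?thesis using prod_prime_factors[of n] n by (simp add: P_def)
      qed
      hence "\<Prod>(P - {..T}) dvd n" using finP by (meson Diff_subset dvd_trans prod_dvd_prod_subset)
      thus "real (\<Prod>p\<in>P - {..T}. p) \<le> real n" using n by (metis dvd_imp_le of_nat_le_iff)
    qed (use assms in \<open>auto intro: prod_nonneg\<close>)
    finally show "(2 :: real) ^ card (P - {..T}) \<le> real n powr \<delta>" .
  qed auto
  finally show "real (card {d. squarefree d \<and> d dvd n}) \<le> 2 ^ Suc T * real n powr \<delta>" .
qed


section \<open>Cube roots modulo squares\<close>

text \<open>A prime allows at most three roots, fewer than 4, the square of its number of divisors.
  All primes are treated at once by an injection into pairs of divisors of \<open>e\<close>, each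
  recording at which primes two roots agree.\<close>

lemma cube_roots_mod_squarefree_square:
  fixes R :: "int set" and k e :: int
  assumes e: "e > 0" "squarefree e" "coprime e 3"
    and R: "\<And>b. b \<in> R \<Longrightarrow> e\<^sup>2 dvd b ^ 3 - k" "\<And>b. b \<in> R \<Longrightarrow> coprime e b"
    and range: "\<And>b. b \<in> R \<Longrightarrow> 0 \<le> b" "\<And>b. b \<in> R \<Longrightarrow> b < e\<^sup>2"
  shows "card R \<le> (card {d. d > 0 \<and> d dvd e})\<^sup>2"
proof (cases "R = {}")
  case True
  thus ?thesis by simp
next
  case False
  then obtain b0 where b0: "b0 \<in> R" by blast
  define g where "g = (\<lambda>b. gcd (b - b0) e)"
  define rep where "rep = (\<lambda>d. SOME b. b \<in> R \<and> g b = d)"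
  have rep: "rep (g b) \<in> R" "g (rep (g b)) = g b" if "b \<in> R" for b
    unfolding rep_def using someI_ex[of "\<lambda>b'. b' \<in> R \<and> g b' = g b"] that by blast+
  \<comment> \<open>Modulo a prime, a cube root distinct from two given distinct ones is minus their sum; so \<open>b\<close>
    modulo \<open>e\<close> is known once we know at which primes it agrees with \<open>b0\<close> and, for the class of \<open>b\<close>
    under \<open>g\<close>, with a fixed member of that class. Roots modulo \<open>e\<close> lift uniquely.\<close>
  define \<phi> where "\<phi> = (\<lambda>b. (g b, gcd (b - rep (g b)) e))"
  have "inj_on \<phi> R"
  proof (rule inj_onI)
    fix b b' assume b: "b \<in> R" and b': "b' \<in> R" and eq: "\<phi> b = \<phi> b'"
    define b1 where "b1 = rep (g b)"
    have b1: "b1 \<in> R" "g b1 = g b" using rep b by (auto simp: b1_def)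
    have g': "g b' = g b" and h': "gcd (b' - b1) e = gcd (b - b1) e"
      using eq by (auto simp: \<phi>_def b1_def)
    have prime_case: "p dvd b - b'" if p: "prime p" "p dvd e" for p :: int
    proof -
      have iff0: "p dvd x - b0 \<longleftrightarrow> p dvd g x" for x
        using p by (simp add: g_def)
      have iff1: "p dvd x - b1 \<longleftrightarrow> p dvd gcd (x - b1) e" for x
        using p by simp
      have cube: "p dvd x ^ 3 - k" if "x \<in> R" for x
        using R(1)[OF that] p(2) by (metis dvd_trans dvd_power zero_less_numeral dvd_refl)
      have quot: "p dvd x\<^sup>2 + x * y + y\<^sup>2" if "x \<in> R" "y \<in> R" "\<not> p dvd x - y" for x y
      proof -
        have "p dvd (x ^ 3 - k) - (y ^ 3 - k)" using cube[OF that(1)] cube[OF that(2)] by (rule dvd_diff)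
        also have "\<dots> = (x - y) * (x\<^sup>2 + x * y + y\<^sup>2)"
          by (simp add: power2_eq_square power3_eq_cube algebra_simps)
        finally show ?thesis using p(1) that(3) by (simp add: prime_dvd_mult_iff)
      qed
      \<comment> \<open>The difference of two quotient relations factors once more, so three roots
        that are pairwise distinct modulo \<open>p\<close> have sum 0 there.\<close>
      have third: "p dvd x + b1 + b0" if x: "x \<in> R" "\<not> p dvd x - b0" "\<not> p dvd x - b1" "\<not> p dvd b1 - b0" for x
      proof -
        have "p dvd (x\<^sup>2 + x * b0 + b0\<^sup>2) - (b1\<^sup>2 + b1 * b0 + b0\<^sup>2)"
          using x b0 b1 by (intro dvd_diff quot) auto
        also have "\<dots> = (x - b1) * (x + b1 + b0)"
          by (simp add: power2_eq_square algebra_simps)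
        finally show ?thesis using p(1) x(3) by (simp add: prime_dvd_mult_iff)
      qed
      consider "p dvd b - b0" | "p dvd b - b1" | "\<not> p dvd b - b0" "\<not> p dvd b - b1" by blast
      thus ?thesis
      proof cases
        case 1
        hence "p dvd b' - b0" using iff0 g' by metis
        with 1 have "p dvd (b - b0) - (b' - b0)" by (rule dvd_diff)
        thus ?thesis by simp
      next
        case 2
        hence "p dvd b' - b1" using iff1 h' by metis
        with 2 have "p dvd (b - b1) - (b' - b1)" by (rule dvd_diff)
        thus ?thesis by simp
      next
        case 3
        hence n': "\<not> p dvd b' - b0" "\<not> p dvd b' - b1" "\<not> p dvd b1 - b0"
          using iff0 iff1 g' h' b1(2) by metis+
        have "p dvd (b + b1 + b0) - (b' + b1 + b0)"
          using third[of b] third[of b'] b b' 3 n' by (intro dvd_diff) auto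
        thus ?thesis by simp
      qed
    qed
    have "e dvd b - b'"
    proof (cases "b = b'")
      case False
      show ?thesis
      proof (rule multiplicity_le_imp_dvd)
        fix p :: int assume p: "prime p"
        have "multiplicity p e \<le> 1"
          using e p squarefree_factorial_semiring''[of e] by auto
        moreover have "multiplicity p (b - b') \<ge> 1" if "p dvd e"
          using prime_case[OF p that] False p by (intro multiplicity_geI) auto
        moreover have "multiplicity p e = 0" if "\<not> p dvd e"
          using that by (simp add: not_dvd_imp_multiplicity_0)
        ultimately show "multiplicity p e \<le> multiplicity p (b - b')" by fastforce
      qed (use e False in auto)
    qed simp
    then obtain j where j: "b' = b + e * j" by (metis add_diff_cancel_left' dvdE dvd_diff_commute diff_add_cancel add.commute)
    \<comment> \<open>Modulo \<open>e\<close> the cofactor of \<open>b - b'\<close> is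
      \<open>3 b^2\<close>, the derivative of the cube, which is a unit. Hence roots that agree
      modulo \<open>e\<close> agree modulo \<open>e^2\<close>.\<close>
    have "e dvd b\<^sup>2 + b * b' + b'\<^sup>2 - 3 * b\<^sup>2"
      unfolding j by (simp add: power2_eq_square algebra_simps)
    moreover have "coprime e (3 * b\<^sup>2)"
      using e(3) R(2)[OF b] by simp
    ultimately have "coprime e (b\<^sup>2 + b * b' + b'\<^sup>2)"
      by (metis coprime_iff_gcd_eq_1 gcd_add_mult dvdE diff_add_cancel add.commute gcd.commute mult.commute)
    hence cop: "coprime (e\<^sup>2) (b\<^sup>2 + b * b' + b'\<^sup>2)" by simp
    have "e\<^sup>2 dvd (b ^ 3 - k) - (b' ^ 3 - k)" using R(1)[OF b] R(1)[OF b'] by (rule dvd_diff)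
    also have "\<dots> = (b - b') * (b\<^sup>2 + b * b' + b'\<^sup>2)"
      by (simp add: power2_eq_square power3_eq_cube algebra_simps)
    finally have "e\<^sup>2 dvd b - b'" using cop by (simp add: coprime_dvd_mult_left_iff)
    hence "b mod e\<^sup>2 = b' mod e\<^sup>2" by (simp add: mod_eq_dvd_iff)
    thus "b = b'" using range b b' by simp
  qed
  moreover have "\<phi> ` R \<subseteq> {d. d > 0 \<and> d dvd e} \<times> {d. d > 0 \<and> d dvd e}"
    using e(1) by (auto simp: \<phi>_def g_def)
  moreover have "finite {d. d > 0 \<and> d dvd e}" using e(1) by (intro finite_subset[OF _ finite_divisors_int[of e]]) auto
  ultimately have "card R \<le> card ({d. d > 0 \<and> d dvd e} \<times> {d. d > 0 \<and> d dvd e})"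
    by (intro card_inj_on_le[of \<phi>]) auto
  thus ?thesis by (simp add: card_cartesian_product power2_eq_square)
qed

text \<open>An element is fixed by its quotient and its residue, and the quotients fill an interval
  with at most \<open>2 N / n + 2\<close> integers.\<close>

lemma card_interval_residues_le:
  fixes n :: int and N :: real and S :: "int set"
  assumes "n > 0" "N \<ge> 0" "\<And>b. b \<in> S \<Longrightarrow> \<bar>of_int b\<bar> \<le> N"
  shows "finite S" "real (card S) \<le> (2 * N / of_int n + 2) * real (card ((\<lambda>b. b mod n) ` S))"
proof -
  have "S \<subseteq> {- \<lfloor>N\<rfloor>..\<lfloor>N\<rfloor>}"
    using assms(3) by (auto simp: le_floor_iff abs_le_iff minus_le_iff)
  thus fin: "finite S" by (rule finite_subset) auto
  define I where "I = {\<lfloor>- N / of_int n\<rfloor>..\<lfloor>N / of_int n\<rfloor>}"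
  have "inj_on (\<lambda>b. (b div n, b mod n)) S"
    by (rule inj_onI) (metis div_mult_mod_eq prod.inject)
  moreover have "b div n \<in> I" if "b \<in> S" for b
  proof -
    have "b div n = \<lfloor>of_int b / (of_int n :: real)\<rfloor>" by (simp add: floor_divide_of_int_eq)
    moreover have "- N / of_int n \<le> of_int b / of_int n" "of_int b / of_int n \<le> N / of_int n"
      using assms(1) assms(3)[OF that] by (simp_all only: divide_le_cancel) (auto simp: abs_le_iff)
    ultimately show ?thesis unfolding I_def by (simp add: floor_mono)
  qed
  ultimately have "card S \<le> card (I \<times> (\<lambda>b. b mod n) ` S)"
    using fin by (intro card_inj_on_le[of "\<lambda>b. (b div n, b mod n)"]) (auto simp: I_def)
  hence "real (card S) \<le> real (card I) * real (card ((\<lambda>b. b mod n) ` S))"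
    by (simp add: card_cartesian_product flip: of_nat_mult)
  also have "real (card I) \<le> 2 * N / of_int n + 2"
  proof -
    have "N / of_int n \<ge> 0" using assms by simp
    hence "real (card I) = of_int (\<lfloor>N / of_int n\<rfloor> - \<lfloor>- N / of_int n\<rfloor> + 1)"
      unfolding I_def by (simp; linarith)
    also have "\<dots> \<le> 2 * N / of_int n + 2"
      by (simp add: algebra_simps) linarith
    finally show ?thesis .
  qed
  finally show "real (card S) \<le> (2 * N / of_int n + 2) * real (card ((\<lambda>b. b mod n) ` S))"
    by (simp add: mult_right_mono)
qed


section \<open>Pairs with a large common divisor\<close>

text \<open>Leaving out 0 gives a bound without an additive constant, so that products of two such
  bounds can be summed over \<open>d\<close>.\<close>

lemma card_nonzero_multiples_le:
  fixes d :: nat and A :: real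
  assumes "d > 0" "A \<ge> 0"
  shows "finite {a :: int. a \<noteq> 0 \<and> \<bar>of_int a\<bar> \<le> A \<and> int d dvd a}"
    "real (card {a :: int. a \<noteq> 0 \<and> \<bar>of_int a\<bar> \<le> A \<and> int d dvd a}) \<le> 2 * A / d"
proof -
  define N where "N = \<lfloor>A / d\<rfloor>"
  have N: "N \<ge> 0" "of_int N \<le> A / d" using assms by (auto simp: N_def)
  have sub: "{a :: int. a \<noteq> 0 \<and> \<bar>of_int a\<bar> \<le> A \<and> int d dvd a} \<subseteq> (\<lambda>k. int d * k) ` ({- N..N} - {0})"
  proof
    fix a :: int assume a: "a \<in> {a. a \<noteq> 0 \<and> \<bar>of_int a\<bar> \<le> A \<and> int d dvd a}"
    then obtain k where k: "a = int d * k" by auto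
    have "\<bar>of_int k\<bar> \<le> A / d"
      using a assms(1) by (simp add: k abs_mult field_simps)
    hence "\<bar>k\<bar> \<le> N" unfolding N_def by (simp add: le_floor_iff)
    thus "a \<in> (\<lambda>k. int d * k) ` ({- N..N} - {0})"
      using a k by (intro image_eqI[of _ _ k]) auto
  qed
  thus fin: "finite {a :: int. a \<noteq> 0 \<and> \<bar>of_int a\<bar> \<le> A \<and> int d dvd a}"
    by (rule finite_subset) auto
  have "card {a :: int. a \<noteq> 0 \<and> \<bar>of_int a\<bar> \<le> A \<and> int d dvd a} \<le> card ({- N..N} - {0})"
    using sub by (meson card_image_le card_mono finite_Diff finite_atLeastAtMost_int finite_imageI le_trans)
  also have "card ({- N..N} - {0}) = nat (2 * N)" using N(1) by (simp add: card_Diff_singleton_if)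
  finally have "real (card {a :: int. a \<noteq> 0 \<and> \<bar>of_int a\<bar> \<le> A \<and> int d dvd a}) \<le> 2 * of_int N"
    using N(1) by linarith
  also have "\<dots> \<le> 2 * A / d" using N(2) by simp
  finally show "real (card {a :: int. a \<noteq> 0 \<and> \<bar>of_int a\<bar> \<le> A \<and> int d dvd a}) \<le> 2 * A / d" .
qed

text \<open>Each \<open>d\<close> contributes at most \<open>(2 A / d) (2 B / d)\<close>, and the
  tail of the inverse squares saves a factor \<open>D\<close>.\<close>

lemma card_common_divisor_pairs_le:
  fixes A B D :: real
  assumes "A \<ge> 0" "B \<ge> 0" "D > 0"
  defines "S \<equiv> {(a :: int, b :: int). a \<noteq> 0 \<and> b \<noteq> 0 \<and> \<bar>of_int a\<bar> \<le> A \<and> \<bar>of_int b\<bar> \<le> B \<and>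
      (\<exists>d :: nat. real d > D \<and> int d dvd a \<and> int d dvd b)}"
  shows "finite S" "real (card S) \<le> 8 * A * B / D"
proof -
  define M where "M = (\<lambda>(d :: nat) (N :: real). {a :: int. a \<noteq> 0 \<and> \<bar>of_int a\<bar> \<le> N \<and> int d dvd a})"
  define J where "J = {d :: nat. D < real d \<and> real d \<le> A}"
  have "J \<subseteq> {..nat \<lfloor>A\<rfloor>}" by (auto simp: J_def le_nat_floor)
  hence J: "finite J" "\<And>d. d \<in> J \<Longrightarrow> d > 0"
    using finite_subset assms(3) by (auto simp: J_def)
  have sub: "S \<subseteq> (\<Union>d\<in>J. M d A \<times> M d B)"
  proof
    fix x assume x: "x \<in> S"
    then obtain a b d where ab: "x = (a, b)" "a \<noteq> 0" "b \<noteq> 0" "\<bar>of_int a\<bar> \<le> A" "\<bar>of_int b\<bar> \<le> B"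
      and d: "real d > D" "int d dvd a" "int d dvd b" by (auto simp: S_def)
    have "int d \<le> \<bar>a\<bar>" using dvd_imp_le_int[of a "int d"] ab d by simp
    hence "real d \<le> A" using ab(4) by linarith
    thus "x \<in> (\<Union>d\<in>J. M d A \<times> M d B)" using ab d by (auto simp: J_def M_def)
  qed
  have finM: "finite (M d A \<times> M d B)" if "d \<in> J" for d
    using card_nonzero_multiples_le(1)[of d] assms J(2)[OF that] by (simp add: M_def)
  show "finite S" by (rule finite_subset[OF sub]) (use J finM in auto)
  have "card S \<le> card (\<Union>d\<in>J. M d A \<times> M d B)"
    using sub J finM by (intro card_mono) auto
  also have "\<dots> \<le> (\<Sum>d\<in>J. card (M d A \<times> M d B))" by (rule card_UN_le[OF J(1)])
  finally have "real (card S) \<le> real (\<Sum>d\<in>J. card (M d A \<times> M d B))" by (simp only: of_nat_le_iff)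
  also have "\<dots> = (\<Sum>d\<in>J. real (card (M d A)) * real (card (M d B)))"
    by (simp add: card_cartesian_product)
  also have "\<dots> \<le> (\<Sum>d\<in>J. (2 * A / d) * (2 * B / d))"
    using card_nonzero_multiples_le(2) assms J(2) unfolding M_def
    by (intro sum_mono mult_mono) auto
  also have "\<dots> = 4 * A * B * (\<Sum>d\<in>J. 1 / real d ^ 2)"
    by (simp add: sum_distrib_left power2_eq_square field_simps)
  also have "\<dots> \<le> 4 * A * B * (2 / D)"
    using assms J by (intro mult_left_mono sum_tail_inverse_squares) (auto simp: J_def)
  finally show "real (card S) \<le> 8 * A * B / D" by simp
qed

section \<open>Pairs with a coprime square divisor of medium size\<close>

lemma card_int_divisors_eq:
  fixes e :: nat
  assumes "squarefree e"
  shows "card {d :: int. d > 0 \<and> d dvd int e} = card {d. squarefree d \<and> d dvd e}"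
proof -
  have "e > 0" using assms not_squarefree_0 by (metis gr0I)
  have "{d :: int. d > 0 \<and> d dvd int e} = int ` {d. squarefree d \<and> d dvd e}"
  proof (intro equalityI subsetI)
    fix d :: int assume d: "d \<in> {d. d > 0 \<and> d dvd int e}"
    hence "d = int (nat d)" "nat d dvd e" by (auto simp: nat_dvd_iff)
    thus "d \<in> int ` {d. squarefree d \<and> d dvd e}"
      using assms squarefree_mono by (metis (mono_tags, lifting) image_eqI mem_Collect_eq)
  qed (use \<open>e > 0\<close> in \<open>auto intro: dvd_pos_nat\<close>)
  thus ?thesis by (simp add: card_image)
qed

lemma squarefree_int_of_nat:
  fixes e :: nat
  assumes "squarefree e"
  shows "squarefree (int e)"
proof (rule squarefreeI)
  fix x :: int assume "x\<^sup>2 dvd int e"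
  moreover have "x\<^sup>2 = int ((nat \<bar>x\<bar>)\<^sup>2)" by simp
  ultimately have "(nat \<bar>x\<bar>)\<^sup>2 dvd e" by (metis int_dvd_int_iff)
  hence "nat \<bar>x\<bar> dvd 1" using squarefreeD[OF assms] by blast
  thus "x dvd 1" by (simp add: nat_abs_dvd_iff)
qed

text \<open>For fixed \<open>a\<close> and \<open>e\<close> the admissible \<open>b\<close> are cube
  roots of one residue modulo \<open>e^2\<close>, so they occupy few classes. Over
  \<open>D < e \<le> E\<close> the term \<open>2 B / e^2\<close> sums to at most
  \<open>4 B / D\<close> and the constant 2 to at most \<open>2 E\<close>.\<close>

lemma card_coprime_solutions_le:
  fixes \<alpha> \<beta> :: int and A B D E \<delta> C :: real
  assumes "A \<ge> 0" "B \<ge> 0" "D > 0" "\<delta> > 0" "E \<ge> 0"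
    and C: "\<And>n :: nat. n > 0 \<Longrightarrow> real (card {d. squarefree d \<and> d dvd n}) \<le> C * real n powr \<delta>"
  defines "S \<equiv> {(a :: int, b :: int). a \<noteq> 0 \<and> \<bar>of_int a\<bar> \<le> A \<and> \<bar>of_int b\<bar> \<le> B \<and>
      (\<exists>e :: nat. real e > D \<and> real e \<le> E \<and> squarefree e \<and> coprime (int e) (3 * \<alpha>) \<and> coprime (int e) b \<and>
         (int e)\<^sup>2 dvd \<beta> * a ^ 4 + \<alpha> * b ^ 3)}"
  shows "finite S" "real (card S) \<le> 2 * A * (C * E powr \<delta>)\<^sup>2 * (4 * B / D + 2 * E)"
proof -
  define U where "U = {a :: int. a \<noteq> 0 \<and> \<bar>of_int a\<bar> \<le> A}"
  have "U = {a :: int. a \<noteq> 0 \<and> \<bar>of_int a\<bar> \<le> A \<and> int 1 dvd a}" by (simp add: U_def)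
  hence U: "finite U" "real (card U) \<le> 2 * A"
    using card_nonzero_multiples_le[of 1 A] assms(1) by simp_all
  define J where "J = {e :: nat. D < real e \<and> real e \<le> E \<and> squarefree e \<and> coprime (int e) (3 * \<alpha>)}"
  have "J \<subseteq> {1..nat \<lfloor>E\<rfloor>}" using assms by (auto simp: J_def le_nat_floor Suc_le_eq intro!: Nat.gr0I)
  hence J: "finite J" "real (card J) \<le> E"
  proof -
    show "finite J" using \<open>J \<subseteq> _\<close> by (rule finite_subset) auto
    have "card J \<le> card {1..nat \<lfloor>E\<rfloor>}" using \<open>J \<subseteq> _\<close> by (intro card_mono) auto
    thus "real (card J) \<le> E" using assms(5) by simp linarith
  qed
  define V where "V = (\<lambda>(e :: nat) (a :: int). {b :: int. \<bar>of_int b\<bar> \<le> B \<and> coprime (int e) b \<and>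
         (int e)\<^sup>2 dvd \<beta> * a ^ 4 + \<alpha> * b ^ 3})"
  define H where "H = (C * E powr \<delta>)\<^sup>2"
  have V: "finite (V e a)" "real (card (V e a)) \<le> (2 * B / real e ^ 2 + 2) * H" if e: "e \<in> J" for e a
  proof -
    have e0: "e > 0" "squarefree e" using e assms(3) by (auto simp: J_def intro!: Nat.gr0I)
    define R where "R = (\<lambda>b. b mod (int e)\<^sup>2) ` V e a"
    have VB: "\<bar>of_int b\<bar> \<le> B" if "b \<in> V e a" for b using that by (simp add: V_def)
    have "card R \<le> (card {d :: int. d > 0 \<and> d dvd int e})\<^sup>2"
    proof (cases "V e a = {}")
      case False
      \<comment> \<open>One solution supplies the residue \<open>b0^3\<close>, as
        \<open>\<alpha>\<close> is invertible modulo \<open>e^2\<close>.\<close>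
      then obtain b0 where b0: "b0 \<in> V e a" by blast
      show ?thesis
      proof (rule cube_roots_mod_squarefree_square[of _ _ "b0 ^ 3"])
        fix r assume "r \<in> R"
        then obtain b where b: "b \<in> V e a" "r = b mod (int e)\<^sup>2" by (auto simp: R_def)
        have rb: "(int e)\<^sup>2 dvd r - b" using b(2) by (simp add: mod_eq_dvd_iff[symmetric])
        have "(int e)\<^sup>2 dvd (\<beta> * a ^ 4 + \<alpha> * b ^ 3) - (\<beta> * a ^ 4 + \<alpha> * b0 ^ 3)"
          using b(1) b0 unfolding V_def by (intro dvd_diff) auto
        hence "(int e)\<^sup>2 dvd \<alpha> * (b ^ 3 - b0 ^ 3)" by (simp add: algebra_simps)
        moreover have "coprime ((int e)\<^sup>2) \<alpha>" using e by (simp add: J_def)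
        ultimately have "(int e)\<^sup>2 dvd b ^ 3 - b0 ^ 3" by (simp add: coprime_dvd_mult_right_iff)
        moreover have "(int e)\<^sup>2 dvd r ^ 3 - b ^ 3"
        proof -
          have "r ^ 3 - b ^ 3 = (r - b) * (r\<^sup>2 + r * b + b\<^sup>2)"
            by (simp add: power2_eq_square power3_eq_cube algebra_simps)
          thus ?thesis using rb by simp
        qed
        ultimately have "(int e)\<^sup>2 dvd (r ^ 3 - b ^ 3) + (b ^ 3 - b0 ^ 3)" by (rule dvd_add[rotated])
        thus "(int e)\<^sup>2 dvd r ^ 3 - b0 ^ 3" by simp
        have "coprime ((int e)\<^sup>2) b" using b(1) by (simp add: V_def)
        hence "coprime (b mod (int e)\<^sup>2) ((int e)\<^sup>2)"
          using e0 by (subst coprime_mod_left_iff) (auto simp: coprime_commute)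
        hence "coprime ((int e)\<^sup>2) r" unfolding b(2) by (rule coprime_imp_coprime[OF _]) auto
        thus "coprime (int e) r" by simp
        show "0 \<le> r" "r < (int e)\<^sup>2" using b(2) e0 by auto
      qed (use e e0 in \<open>auto simp: J_def intro: squarefree_int_of_nat\<close>)
    qed (simp add: R_def)
    hence "real (card R) \<le> real ((card {d. squarefree d \<and> d dvd e})\<^sup>2)"
      using card_int_divisors_eq[OF e0(2)] by (metis of_nat_le_iff)
    also have "\<dots> \<le> (C * real e powr \<delta>)\<^sup>2"
      using C[OF e0(1)] by simp
    also have "\<dots> \<le> H"
    proof -
      \<comment> \<open>The divisor bound at \<open>n = 1\<close> shows that \<open>C\<close> is
        nonnegative.\<close>
      have "0 \<le> C * real 1 powr \<delta>" by (rule order_trans[OF _ C]) auto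
      thus ?thesis unfolding H_def using e assms(4) by (intro power_mono mult_left_mono powr_mono2) (auto simp: J_def)
    qed
    finally have R: "real (card R) \<le> H" .
    show "finite (V e a)" using card_interval_residues_le(1)[of "(int e)\<^sup>2" B, OF _ assms(2) VB] e0 by auto
    have "real (card (V e a)) \<le> (2 * B / of_int ((int e)\<^sup>2) + 2) * real (card R)"
      unfolding R_def using card_interval_residues_le(2)[of "(int e)\<^sup>2" B, OF _ assms(2) VB] e0 by auto
    also have "\<dots> \<le> (2 * B / of_int ((int e)\<^sup>2) + 2) * H"
      using R assms(2) by (intro mult_left_mono) auto
    finally show "real (card (V e a)) \<le> (2 * B / real e ^ 2 + 2) * H" by simp
  qed
  have sub: "S \<subseteq> (\<Union>e\<in>J. Sigma U (V e))" by (auto simp: S_def J_def U_def V_def)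
  have fin: "finite (Sigma U (V e))" if "e \<in> J" for e using that U V by auto
  show "finite S" by (rule finite_subset[OF sub]) (use J fin in auto)
  have "card S \<le> card (\<Union>e\<in>J. Sigma U (V e))"
    using sub J fin by (intro card_mono) auto
  also have "\<dots> \<le> (\<Sum>e\<in>J. card (Sigma U (V e)))" by (rule card_UN_le[OF J(1)])
  also have "\<dots> = (\<Sum>e\<in>J. \<Sum>a\<in>U. card (V e a))"
    using U V by (intro sum.cong card_SigmaI) auto
  finally have "real (card S) \<le> real (\<Sum>e\<in>J. \<Sum>a\<in>U. card (V e a))" by (simp only: of_nat_le_iff)
  also have "\<dots> = (\<Sum>e\<in>J. \<Sum>a\<in>U. real (card (V e a)))" by simp
  also have "\<dots> \<le> (\<Sum>e\<in>J. \<Sum>a\<in>U. (2 * B / real e ^ 2 + 2) * H)"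
    using V by (intro sum_mono) auto
  also have "\<dots> = (real (card U) * H) * (2 * B * (\<Sum>e\<in>J. 1 / real e ^ 2) + 2 * real (card J))"
    by (simp add: sum.distrib sum_distrib_left sum_distrib_right algebra_simps)
  also have "\<dots> \<le> (2 * A * H) * (2 * B * (2 / D) + 2 * E)"
    using U(2) J assms(1-3,5)
    by (intro mult_mono add_mono mult_left_mono sum_tail_inverse_squares mult_right_mono mult_nonneg_nonneg add_nonneg_nonneg sum_nonneg)
      (auto simp: J_def H_def)
  finally show "real (card S) \<le> 2 * A * (C * E powr \<delta>)\<^sup>2 * (4 * B / D + 2 * E)"
    by (simp add: H_def)
qed

section \<open>Large divisors: integer roots and small forms\<close>

text \<open>Folding \<open>n\<close> onto its absolute value at most doubles a convergent series.
  Convergence is the reason for an exponent above 1 in Rankin's trick.\<close>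

lemma sum_hat_powr_bounded:
  fixes \<sigma> :: real
  assumes "\<sigma> > 1"
  obtains Z where "\<And>A :: int set. finite A \<Longrightarrow> (\<Sum>n\<in>A. hat n powr - \<sigma>) \<le> Z"
proof
  define g where "g = (\<lambda>k :: nat. hat (int k) powr - \<sigma>)"
  have "summable (\<lambda>k :: nat. real k powr - \<sigma>)" using assms by (simp add: summable_real_powr_iff)
  hence "summable (\<lambda>k. real (Suc k) powr - \<sigma>)" by (subst summable_Suc_iff)
  moreover have "g (Suc k) = real (Suc k) powr - \<sigma>" for k by (simp add: g_def hat_def max_def)
  ultimately have "summable (\<lambda>k. g (Suc k))" by (simp only:)
  hence g: "summable g" by (subst (asm) summable_Suc_iff)
  fix A :: "int set" assume A: "finite A"
  define N where "N = nat ` abs ` A"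
  have N: "finite N" using A by (simp add: N_def)
  have "A \<subseteq> int ` N \<union> (\<lambda>k. - int k) ` N"
  proof
    fix n assume n: "n \<in> A"
    hence "nat \<bar>n\<bar> \<in> N" by (auto simp: N_def)
    moreover have "n = int (nat \<bar>n\<bar>) \<or> n = - int (nat \<bar>n\<bar>)" by auto
    ultimately show "n \<in> int ` N \<union> (\<lambda>k. - int k) ` N" by blast
  qed
  hence "(\<Sum>n\<in>A. hat n powr - \<sigma>) \<le> (\<Sum>n\<in>int ` N \<union> (\<lambda>k. - int k) ` N. hat n powr - \<sigma>)"
    using N by (intro sum_mono2) auto
  also have "\<dots> \<le> (\<Sum>n\<in>int ` N. hat n powr - \<sigma>) + (\<Sum>n\<in>(\<lambda>k. - int k) ` N. hat n powr - \<sigma>)"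
    using N by (simp add: sum_Un sum_nonneg)
  also have "\<dots> = 2 * sum g N"
    by (subst (1 2) sum.reindex) (auto simp: inj_on_def g_def hat_def o_def)
  also have "\<dots> \<le> 2 * suminf g"
    using N g by (intro mult_left_mono sum_le_suminf) (auto simp: g_def)
  finally show "(\<Sum>n\<in>A. hat n powr - \<sigma>) \<le> 2 * suminf g" .
qed


lemma card_abs_le_bound:
  fixes A :: real
  assumes "A \<ge> 0"
  shows "finite {a :: int. \<bar>of_int a\<bar> \<le> A}" "real (card {a :: int. \<bar>of_int a\<bar> \<le> A}) \<le> 2 * A + 1"
proof -
  have "{a :: int. \<bar>of_int a\<bar> \<le> A} = {- \<lfloor>A\<rfloor>..\<lfloor>A\<rfloor>}"
    by (auto simp: le_floor_iff abs_le_iff minus_le_iff)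
  thus "finite {a :: int. \<bar>of_int a\<bar> \<le> A}" "real (card {a :: int. \<bar>of_int a\<bar> \<le> A}) \<le> 2 * A + 1"
    using assms by simp_all
qed

text \<open>The equation is linear in \<open>b\<close>, so \<open>a\<close> and a nonzero integer
  root determine \<open>b\<close>; every root is at most \<open>2 Y^2\<close> in absolute
  value.\<close>

lemma card_integer_root_pairs_le:
  fixes \<alpha> \<beta> Y :: int and A B :: real
  assumes "\<alpha> \<noteq> 0" "\<beta> \<noteq> 0" "A \<ge> 0" "Y \<ge> 1"
  defines "S \<equiv> {(a :: int, b :: int). a \<noteq> 0 \<and> \<bar>of_int a\<bar> \<le> A \<and>
      \<bar>\<alpha> * \<beta> * b\<bar> \<le> Y ^ 4 \<and> \<bar>\<alpha> * \<beta>\<^sup>2 * a\<^sup>2\<bar> \<le> Y ^ 6 \<and>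
      (\<exists>z. z ^ 3 + 3 * (\<alpha> * \<beta> * b) * z = 2 * (\<alpha> * \<beta>\<^sup>2 * a\<^sup>2))}"
  shows "finite S" "real (card S) \<le> (2 * A + 1) * (5 * of_int Y ^ 2)"
proof -
  define U where "U = {a :: int. \<bar>of_int a\<bar> \<le> A}"
  define W where "W = {- (2 * Y\<^sup>2)..2 * Y\<^sup>2}"
  define root where "root = (\<lambda>(a, b). SOME z. z ^ 3 + 3 * (\<alpha> * \<beta> * b) * z = 2 * (\<alpha> * \<beta>\<^sup>2 * a\<^sup>2))"
  have root: "root (a, b) ^ 3 + 3 * (\<alpha> * \<beta> * b) * root (a, b) = 2 * (\<alpha> * \<beta>\<^sup>2 * a\<^sup>2)" if "(a, b) \<in> S" for a b
    using that unfolding S_def root_def by (auto intro: someI_ex)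
  \<comment> \<open>A zero root would force \<open>a = 0\<close>.\<close>
  have nz: "root (a, b) \<noteq> 0" if "(a, b) \<in> S" for a b
    using root[OF that] that assms(1,2) by (auto simp: S_def)
  have small: "root (a, b) \<in> W" if ab: "(a, b) \<in> S" for a b
  proof (rule ccontr)
    define z where "z = root (a, b)"
    define u where "u = \<bar>z\<bar>"
    assume "root (a, b) \<notin> W"
    \<comment> \<open>For such \<open>u\<close> the terms \<open>2 Y^6\<close> and
      \<open>3 Y^4 u\<close> together are at most \<open>4 Y^4 u\<close>, which is below
      \<open>u^3\<close>.\<close>
    hence u: "u > 2 * Y\<^sup>2" by (auto simp: W_def u_def z_def)
    have "z ^ 3 = 2 * (\<alpha> * \<beta>\<^sup>2 * a\<^sup>2) - 3 * (\<alpha> * \<beta> * b) * z"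
      using root[OF ab] by (simp add: z_def)
    hence "u ^ 3 = \<bar>2 * (\<alpha> * \<beta>\<^sup>2 * a\<^sup>2) - 3 * (\<alpha> * \<beta> * b) * z\<bar>"
      by (simp add: u_def flip: power_abs)
    also have "\<dots> \<le> 2 * \<bar>\<alpha> * \<beta>\<^sup>2 * a\<^sup>2\<bar> + 3 * \<bar>\<alpha> * \<beta> * b\<bar> * u"
      unfolding u_def by (rule order_trans[OF abs_triangle_ineq4]) (simp add: abs_mult)
    also have "\<dots> \<le> 2 * Y ^ 6 + 3 * Y ^ 4 * u"
      using ab by (intro add_mono mult_mono) (auto simp: S_def u_def)
    also have "2 * Y ^ 6 = Y ^ 4 * (2 * Y\<^sup>2)" by (simp flip: power_add)
    also have "Y ^ 4 * (2 * Y\<^sup>2) + 3 * Y ^ 4 * u \<le> Y ^ 4 * u + 3 * Y ^ 4 * u"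
      using u assms(4) by (intro add_mono mult_left_mono) auto
    also have "\<dots> = (2 * Y\<^sup>2)\<^sup>2 * u" by (simp add: power_mult_distrib flip: power_mult)
    also have "\<dots> < u\<^sup>2 * u"
      using u assms(4) by (intro mult_strict_right_mono power_strict_mono) (auto simp: u_def)
    finally show False by (simp add: power2_eq_square power3_eq_cube)
  qed
  have "inj_on (\<lambda>x. (fst x, root x)) S"
  proof (rule inj_onI)
    fix x x' assume x: "x \<in> S" "x' \<in> S" "(fst x, root x) = (fst x', root x')"
    obtain a b b' where eq: "x = (a, b)" "x' = (a, b')" using x(3) by (metis prod.collapse prod.inject)
    have r: "root (a, b') = root (a, b)" using x(3) eq by simp
    have "3 * (\<alpha> * \<beta> * b) * root (a, b) = 3 * (\<alpha> * \<beta> * b') * root (a, b)"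
      using root[of a b] root[of a b', unfolded r] x unfolding eq by linarith
    thus "x = x'" using nz[of a b] x assms(1,2) unfolding eq by simp
  qed
  moreover have sub: "(\<lambda>x. (fst x, root x)) ` S \<subseteq> U \<times> W"
    using small by (auto simp: S_def U_def)
  moreover have fin: "finite (U \<times> W)" using card_abs_le_bound[OF assms(3)] by (simp add: U_def W_def)
  ultimately show "finite S" by (meson finite_imageD finite_subset)
  have "card S \<le> card (U \<times> W)" using \<open>inj_on _ S\<close> sub fin by (rule card_inj_on_le)
  hence "real (card S) \<le> real (card U) * real (card W)"
    by (simp add: card_cartesian_product flip: of_nat_mult)
  also have "\<dots> \<le> (2 * A + 1) * (5 * of_int Y ^ 2)"
  proof (intro mult_mono)
    have "real (card W) = of_int (4 * Y\<^sup>2 + 1)" by (simp add: W_def)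
    also have "\<dots> \<le> of_int (5 * Y\<^sup>2)"
      using assms(4) unfolding of_int_le_iff by (smt (verit) one_le_power)
    finally show "real (card W) \<le> 5 * of_int Y ^ 2" by simp
  qed (use card_abs_le_bound[OF assms(3)] assms(3) in \<open>auto simp: U_def\<close>)
  finally show "real (card S) \<le> (2 * A + 1) * (5 * of_int Y ^ 2)" .
qed

text \<open>The six integers of the small form are counted by Rankin's trick, and they give back
  \<open>\<alpha> * \<beta> * b\<close> and \<open>\<alpha> * \<beta>\<^sup>2 * a\<^sup>2\<close>,
  hence \<open>b\<close> and the square of \<open>a\<close>.\<close>

lemma card_large_conductor_pairs_le:
  fixes \<alpha> \<beta> Y :: int and E \<sigma> Z :: real
  assumes nz: "\<alpha> \<noteq> 0" "\<beta> \<noteq> 0" and Y: "Y \<ge> 1" and E: "E \<ge> of_int Y ^ 2" and \<sigma>: "\<sigma> > 0"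
    and Z: "\<And>A :: int set. finite A \<Longrightarrow> (\<Sum>n\<in>A. hat n powr - \<sigma>) \<le> Z"
  defines "S \<equiv> {(a :: int, b :: int).
      \<bar>\<alpha> * \<beta> * b\<bar> \<le> Y ^ 4 \<and> \<bar>\<alpha> * \<beta>\<^sup>2 * a\<^sup>2\<bar> \<le> Y ^ 6 \<and>
      (\<forall>z. z ^ 3 + 3 * (\<alpha> * \<beta> * b) * z \<noteq> 2 * (\<alpha> * \<beta>\<^sup>2 * a\<^sup>2)) \<and>
      (\<exists>e :: int. of_int e > E \<and> coprime e (\<alpha> * \<beta> * b) \<and>
         e\<^sup>2 dvd (\<alpha> * \<beta>\<^sup>2 * a\<^sup>2)\<^sup>2 + (\<alpha> * \<beta> * b) ^ 3)}"
  shows "finite S" "real (card S) \<le> 2 * (Z ^ 6 * (165888 * of_int Y ^ 10 / E) powr \<sigma>)"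
proof -
  define B where "B = 165888 * of_int Y ^ 10 / E"
  define T where "T = {xs. length xs = 6 \<and> prod_list (map hat xs) \<le> B}"
  have "E > 0" using E Y by (smt (verit) of_int_1_le_iff one_le_power)
  have "B \<ge> 0" using Y \<open>E > 0\<close> by (simp add: B_def)
  have "{x. hat x \<le> B} \<subseteq> {- \<lfloor>B\<rfloor>..\<lfloor>B\<rfloor>}"
    by (auto simp: hat_def le_floor_iff abs_le_iff minus_le_iff)
  hence finhat: "finite {x. hat x \<le> B}" by (rule finite_subset) auto
  have T: "finite T" "real (card T) \<le> Z ^ 6 * B powr \<sigma>"
    using card_bounded_product_lists[OF \<sigma> \<open>B \<ge> 0\<close> hat_ge_1 finhat Z, of 6] by (simp_all add: T_def)
  define rel where "rel = (\<lambda>xs (a, b). xs \<in> T \<and>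
    \<alpha> * \<beta> * b = hess (xs ! 0) (xs ! 1) (xs ! 2) (xs ! 3) (xs ! 4) (xs ! 5) \<and>
    2 * (\<alpha> * \<beta>\<^sup>2 * a\<^sup>2) = jac (xs ! 0) (xs ! 1) (xs ! 2) (xs ! 3) (xs ! 4) (xs ! 5))"
  have ex: "\<exists>xs. rel xs x" if x: "x \<in> S" for x
  proof -
    obtain a b e where ab: "x = (a, b)" and b: "\<bar>\<alpha> * \<beta> * b\<bar> \<le> Y ^ 4" and c: "\<bar>\<alpha> * \<beta>\<^sup>2 * a\<^sup>2\<bar> \<le> Y ^ 6"
      and noroot: "\<And>z. z ^ 3 + 3 * (\<alpha> * \<beta> * b) * z \<noteq> 2 * (\<alpha> * \<beta>\<^sup>2 * a\<^sup>2)"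
      and e: "of_int e > E" "coprime e (\<alpha> * \<beta> * b)" "e\<^sup>2 dvd (\<alpha> * \<beta>\<^sup>2 * a\<^sup>2)\<^sup>2 + (\<alpha> * \<beta> * b) ^ 3"
      using x unfolding S_def by blast
    have "of_int Y ^ 2 \<le> (of_int e :: real)" using e(1) E by linarith
    hence "e \<ge> Y\<^sup>2" by (metis of_int_le_iff of_int_power)
    from small_form_representation[OF Y this e(2,3) b c noroot]
    obtain p q r s x' y where
      h: "hat p * hat q * hat r * hat s * hat x' * hat y * e \<le> 165888 * of_int Y ^ 10"
      "\<alpha> * \<beta> * b = hess p q r s x' y" "2 * (\<alpha> * \<beta>\<^sup>2 * a\<^sup>2) = jac p q r s x' y" by metis
    have prod: "prod_list (map hat [p, q, r, s, x', y]) = hat p * hat q * hat r * hat s * hat x' * hat y"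
      by simp
    have "hat p * hat q * hat r * hat s * hat x' * hat y * E \<le> hat p * hat q * hat r * hat s * hat x' * hat y * e"
      using e(1) by (intro mult_left_mono mult_nonneg_nonneg) (auto simp: hat_def)
    with h(1) have "hat p * hat q * hat r * hat s * hat x' * hat y \<le> B"
      using \<open>E > 0\<close> by (simp add: B_def pos_le_divide_eq)
    hence "[p, q, r, s, x', y] \<in> T" unfolding T_def mem_Collect_eq prod by simp
    hence "rel [p, q, r, s, x', y] (a, b)" using h(2,3) by (simp add: rel_def)
    thus ?thesis using ab by blast
  qed
  define ch where "ch = (\<lambda>x. SOME xs. rel xs x)"
  have ch: "rel (ch x) x" if "x \<in> S" for x unfolding ch_def using ex[OF that] by (rule someI_ex)
  \<comment> \<open>The Boolean stores the sign of \<open>a\<close>, which the square does not show;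
    this is the factor 2 in the bound.\<close>
  have "inj_on (\<lambda>x. (ch x, fst x \<ge> 0)) S"
  proof (rule inj_onI)
    fix x x' assume x: "x \<in> S" "x' \<in> S" and eq: "(ch x, fst x \<ge> 0) = (ch x', fst x' \<ge> 0)"
    obtain a b a' b' where ab: "x = (a, b)" "x' = (a', b')" by (metis surj_pair)
    have "rel (ch x) (a, b)" "rel (ch x) (a', b')" using ch[OF x(1)] ch[OF x(2)] eq ab by auto
    hence "\<alpha> * \<beta> * b = \<alpha> * \<beta> * b'" "2 * (\<alpha> * \<beta>\<^sup>2 * a\<^sup>2) = 2 * (\<alpha> * \<beta>\<^sup>2 * a'\<^sup>2)"
      unfolding rel_def by auto
    hence "b = b'" "a\<^sup>2 = a'\<^sup>2" using nz by auto
    moreover from this(2) have "a = a'" using eq ab by (auto simp: power2_eq_iff)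
    ultimately show "x = x'" using ab by simp
  qed
  moreover have sub: "(\<lambda>x. (ch x, fst x \<ge> 0)) ` S \<subseteq> T \<times> UNIV"
    using ch by (auto simp: rel_def)
  moreover have fin: "finite (T \<times> (UNIV :: bool set))" using T by simp
  ultimately show "finite S" by (meson finite_imageD finite_subset)
  have "card S \<le> card (T \<times> (UNIV :: bool set))" using \<open>inj_on _ S\<close> sub fin by (rule card_inj_on_le)
  hence "real (card S) \<le> 2 * real (card T)"
    by (simp add: card_cartesian_product)
  also have "\<dots> \<le> 2 * (Z ^ 6 * B powr \<sigma>)" using T(2) by simp
  finally show "real (card S) \<le> 2 * (Z ^ 6 * (165888 * of_int Y ^ 10 / E) powr \<sigma>)" by (simp add: B_def)
qed

section \<open>Splitting a square divisor\<close>

text \<open>Removing from \<open>m\<close> the primes of \<open>3 * \<alpha> * \<beta>\<close> costs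
  a bounded factor \<open>f\<close>. Of the remaining primes, \<open>d\<close> collects those
  dividing \<open>b\<close> and \<open>e\<close> the others. As \<open>d\<close> divides the whole
  expression and \<open>b\<close>, and is coprime to \<open>\<beta>\<close>, it divides
  \<open>a^4\<close>; being squarefree, it divides \<open>a\<close>.\<close>

lemma squarefree_square_divisor_split:
  fixes \<alpha> \<beta> a b :: int and m :: nat
  assumes nz: "\<alpha> \<noteq> 0" "\<beta> \<noteq> 0" and m: "squarefree m" and dvd: "(int m)\<^sup>2 dvd \<beta> * a ^ 4 + \<alpha> * b ^ 3"
  obtains d e :: nat where "squarefree e" "int d dvd a" "int d dvd b" "coprime (int e) (3 * \<alpha> * \<beta>)"
    "coprime (int e) b" "(int e)\<^sup>2 dvd \<beta> * a ^ 4 + \<alpha> * b ^ 3" "int m \<le> \<bar>3 * \<alpha> * \<beta>\<bar> * (int d * int e)"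
proof -
  define K where "K = nat \<bar>3 * \<alpha> * \<beta>\<bar>"
  have K: "K > 0" "int K = \<bar>3 * \<alpha> * \<beta>\<bar>" using nz by (auto simp: K_def)
  \<comment> \<open>\<open>f\<close>, \<open>d\<close> and \<open>e\<close> are pairwise coprime, as \<open>m\<close> is squarefree.\<close>
  define f where "f = gcd m K"
  obtain m1 where m1: "m = f * m1" by (metis dvdE f_def gcd_dvd1)
  define d where "d = gcd m1 (nat \<bar>b\<bar>)"
  obtain e where e: "m1 = d * e" by (metis dvdE d_def gcd_dvd1)
  have m0: "m \<noteq> 0" using m by (metis not_squarefree_0)
  have cop_sq: "coprime x y" if "squarefree (x * y)" for x y :: nat
  proof (rule coprimeI)
    fix c assume "c dvd x" "c dvd y"
    hence "c\<^sup>2 dvd x * y" by (simp add: power2_eq_square mult_dvd_mono)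
    thus "is_unit c" using that squarefreeD by blast
  qed
  have sqm1: "squarefree m1" using m m1 squarefree_multD by blast
  have sqe: "squarefree e" "squarefree d" using sqm1 e squarefree_multD by blast+
  have cop1: "coprime m1 K"
  proof (rule coprimeI)
    fix c assume c: "c dvd m1" "c dvd K"
    have "c dvd m" by (metis c(1) m1 dvd_mult)
    hence "c dvd f" using c(2) unfolding f_def by (rule gcd_greatest)
    with c(1) show "is_unit c" using cop_sq[of f m1] m m1 by (meson coprime_common_divisor)
  qed
  have cop2: "coprime e (nat \<bar>b\<bar>)"
  proof (rule coprimeI)
    fix c assume c: "c dvd e" "c dvd nat \<bar>b\<bar>"
    have "c dvd m1" by (metis c(1) e dvd_mult)
    hence "c dvd d" using c(2) unfolding d_def by (rule gcd_greatest)
    with c(1) show "is_unit c" using cop_sq[of d e] sqm1 e by (meson coprime_common_divisor)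
  qed
  have db: "int d dvd b" by (metis d_def gcd_dvd2 int_dvd_int_iff dvd_abs_iff int_nat_eq abs_ge_zero nat_0_le)
  have dm: "d dvd m" "e dvd m" using m1 e by auto
  have "int d dvd \<beta> * a ^ 4 + \<alpha> * b ^ 3" "(int e)\<^sup>2 dvd \<beta> * a ^ 4 + \<alpha> * b ^ 3"
    using dvd dm by (meson dvd_trans dvd_power_same int_dvd_int_iff dvd_power zero_less_numeral)+
  moreover have "int d dvd \<alpha> * b ^ 3" using db by (simp add: dvd_power_same dvd_trans[OF _ dvd_power])
  ultimately have "int d dvd \<beta> * a ^ 4" by (metis dvd_add_left_iff)
  moreover have coK: "coprime (int x) (3 * \<alpha> * \<beta>)" if "x dvd m1" for x
  proof -
    have "coprime x K" using cop1 that by (meson coprime_divisors dvd_refl)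
    hence "coprime (int x) (int K)" by simp
    thus ?thesis unfolding K(2) by (simp only: coprime_abs_right_iff)
  qed
  hence "coprime (int d) \<beta>" using coK[of d] e by simp
  ultimately have da4: "int d dvd a ^ 4" by (simp add: coprime_dvd_mult_right_iff)
  have "int d dvd a"
  proof (cases "a = 0")
    case False
    show ?thesis
    proof (rule multiplicity_le_imp_dvd)
      have sd: "squarefree (int d)" "int d \<noteq> 0" using sqe(2) m0 dm by (auto intro: squarefree_int_of_nat)
      thus "int d \<noteq> 0" by simp
      fix p :: int assume p: "prime p"
      have "multiplicity p (int d) \<le> 1" using sd p squarefree_factorial_semiring''[of "int d"] by auto
      moreover have "multiplicity p (int d) = 0" if "\<not> p dvd a"
      proof -
        have "\<not> p dvd int d" using that da4 p by (meson dvd_trans prime_dvd_power)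
        thus ?thesis by (simp add: not_dvd_imp_multiplicity_0)
      qed
      moreover have "multiplicity p a \<ge> 1" if "p dvd a"
        using that False p by (intro multiplicity_geI) auto
      ultimately show "multiplicity p (int d) \<le> multiplicity p a" by fastforce
    qed
  qed simp
  moreover have "coprime (int e) b"
  proof -
    have "coprime (int e) (int (nat \<bar>b\<bar>))" using cop2 by (simp only: coprime_int_iff)
    thus ?thesis by simp
  qed
  moreover have "int m \<le> \<bar>3 * \<alpha> * \<beta>\<bar> * (int d * int e)"
  proof -
    have "f \<le> K" unfolding f_def using K(1) by (simp add: gcd_le2_nat)
    hence "m \<le> K * (d * e)" unfolding m1 e by simp
    hence "int m \<le> int (K * (d * e))" by (simp only: of_nat_le_iff)
    thus ?thesis using K(2) by simp
  qed
  ultimately show thesis using that[of e d] sqe(1) db coK[of e] e \<open>(int e)\<^sup>2 dvd _\<close> by simp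
qed


section \<open>Combining the ranges\<close>

text \<open>This is the union over \<open>m > M\<close> of the sets behind \<open>N_count\<close>;
  the sum of their sizes exceeds the size of the union only by a divisor bound.\<close>

definition divisible_pairs :: "int \<Rightarrow> int \<Rightarrow> real \<Rightarrow> real \<Rightarrow> (int \<times> int) set" where
  "divisible_pairs \<alpha> \<beta> M X = {(a, b). \<bar>of_int a\<bar> \<le> X ^ 3 \<and> \<bar>of_int b\<bar> \<le> X ^ 4 \<and>
     \<beta> * a ^ 4 + \<alpha> * b ^ 3 \<noteq> 0 \<and>
     (\<exists>m. squarefree m \<and> real m > M \<and> (int m)\<^sup>2 dvd \<beta> * a ^ 4 + \<alpha> * b ^ 3)}"

text \<open>Five sets cover the pairs: \<open>S0\<close> those on the axes, \<open>S1\<close> those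
  with a large common divisor, \<open>S2\<close> and \<open>S3\<close> those with a coprime square
  divisor of medium or large root, \<open>S4\<close> those whose cubic has an integer root.\<close>

lemma card_divisible_pairs_le:
  fixes \<alpha> \<beta> :: int and \<eta> :: real
  assumes nz: "\<alpha> \<noteq> 0" "\<beta> \<noteq> 0" and \<eta>: "\<eta> > 0"
  obtains C where "C \<ge> 0"
    "\<And>M X. M > 0 \<Longrightarrow> X \<ge> 1 \<Longrightarrow> finite (divisible_pairs \<alpha> \<beta> M X) \<and>
       real (card (divisible_pairs \<alpha> \<beta> M X)) \<le> C * (X powr (7 + \<eta>) / sqrt M + X powr 6.9)"
proof -
  define K where "K = \<bar>\<alpha> * \<beta>\<bar>"
  have K: "K \<ge> 1" using nz by (simp add: K_def int_one_le_iff_zero_less)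
  have K2: "\<bar>\<alpha> * \<beta>\<^sup>2\<bar> \<le> K\<^sup>2"
  proof -
    have "\<bar>\<alpha>\<bar> * 1 \<le> \<bar>\<alpha>\<bar> * \<bar>\<alpha>\<bar>" using nz by (intro mult_left_mono) (auto simp: int_one_le_iff_zero_less)
    hence "\<bar>\<alpha>\<bar> * \<beta>\<^sup>2 \<le> \<bar>\<alpha>\<bar> * \<bar>\<alpha>\<bar> * \<beta>\<^sup>2" by (intro mult_right_mono) auto
    thus ?thesis by (simp add: K_def abs_mult power_mult_distrib power2_eq_square mult_ac)
  qed
  \<comment> \<open>With \<open>\<sigma> = 21/20\<close> the last range contributes the exponent \<open>6.5 \<sigma> = 6.825\<close>; the middle range
    contributes \<open>6.5 + \<theta> \<le> 6.9\<close>.\<close>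
  define \<theta> where "\<theta> = min \<eta> (2 / 5)"
  \<comment> \<open>\<open>E\<close> has order \<open>X powr (7 / 2)\<close> and enters as
    \<open>(E powr \<delta>)\<^sup>2\<close>, a loss of order \<open>X powr (7 * \<delta>)\<close>,
    that is \<open>X powr \<theta>\<close>.\<close>
  define \<delta> where "\<delta> = \<theta> / 7"
  have \<theta>: "0 < \<theta>" "\<theta> \<le> \<eta>" "\<theta> \<le> 2 / 5" and \<delta>: "\<delta> > 0" using \<eta> by (auto simp: \<theta>_def \<delta>_def)
  obtain C0 where C0: "C0 > 0"
    "\<And>n :: nat. n > 0 \<Longrightarrow> real (card {d. squarefree d \<and> d dvd n}) \<le> C0 * real n powr \<delta>"
    using card_squarefree_divisors_le[OF \<delta>] by metis
  obtain Z where Z: "\<And>A :: int set. finite A \<Longrightarrow> (\<Sum>n\<in>A. hat n powr - (21 / 20)) \<le> Z"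
    using sum_hat_powr_bounded[of "21 / 20"] by auto
  have "Z \<ge> 0" using Z[of "{}"] by simp
  define \<kappa> :: real where "\<kappa> = 2 * of_int K"
  have \<kappa>: "\<kappa> \<ge> 1" using K by (simp add: \<kappa>_def)
  \<comment> \<open>With this \<open>q\<close> the threshold \<open>D = sqrt M / q\<close> satisfies
    \<open>D^2 = M / (3 K)\<close>, so \<open>m \<le> 3 K d e\<close> and \<open>m > M\<close> force
    \<open>d\<close> or \<open>e\<close> beyond \<open>D\<close>.\<close>
  define q where "q = sqrt (3 * of_int K)"
  have q: "q > 0" using K by (simp add: q_def)
  define c2 where "c2 = 2 * (C0 * \<kappa> powr (7 / 2 * \<delta>))\<^sup>2"
  define c3 where "c3 = 2 * (Z ^ 6 * (165888 * \<kappa> powr (13 / 2)) powr (21 / 20))"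
  define C where "C = 6 + 8 * q + c2 * (4 * q) + c2 * (2 * \<kappa> powr (7 / 2)) + c3 + 15 * \<kappa>\<^sup>2"
  have "c2 \<ge> 0" "c3 \<ge> 0" using \<open>Z \<ge> 0\<close> by (auto simp: c2_def c3_def)
  hence "C \<ge> 0" using q by (simp add: C_def)
  moreover have "finite (divisible_pairs \<alpha> \<beta> M X) \<and>
      real (card (divisible_pairs \<alpha> \<beta> M X)) \<le> C * (X powr (7 + \<eta>) / sqrt M + X powr 6.9)"
    if M: "M > 0" and X: "X \<ge> 1" for M X
  proof -
    \<comment> \<open>An integer of the order of \<open>X\<close>; its factor \<open>K\<close>
      absorbs the coefficients in the bounds \<open>Y^4\<close> for
      \<open>\<alpha> * \<beta> * b\<close> and \<open>Y^6\<close> for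
      \<open>\<alpha> * \<beta>\<^sup>2 * a\<^sup>2\<close>.\<close>
    define Y where "Y = K * \<lceil>X\<rceil>"
    have "\<lceil>X\<rceil> \<ge> 1" using X by linarith
    hence Y1: "Y \<ge> 1" using K mult_mono[of 1 K 1 "\<lceil>X\<rceil>"] by (simp add: Y_def)
    have Ylow: "of_int K * X \<le> of_int Y" unfolding Y_def of_int_mult using K by (intro mult_left_mono) auto
    have Yup: "of_int Y \<le> \<kappa> * X"
    proof -
      have "of_int \<lceil>X\<rceil> \<le> 2 * X" using X by linarith
      hence "of_int K * of_int \<lceil>X\<rceil> \<le> of_int K * (2 * X)" using K by (intro mult_left_mono) auto
      thus ?thesis by (simp add: Y_def \<kappa>_def mult_ac)
    qed
    have Xp: "X ^ n \<ge> 1" for n using X by simp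
    define D :: real where "D = sqrt M / q"
    \<comment> \<open>This cut balances the medium range, about \<open>X^3 E\<close>, with the large
      range, about \<open>Y^10 / E\<close>: both have exponent 13/2.\<close>
    define E :: real where "E = of_int Y powr (7 / 2)"
    have D: "D > 0" using M q by (simp add: D_def)
    have y1: "of_int Y \<ge> (1 :: real)" using Y1 by simp
    have E: "E \<ge> of_int Y ^ 2"
      using powr_mono[of 2 "7 / 2" "of_int Y"] y1 by (simp add: E_def)
    have E0: "E \<ge> 0" by (simp add: E_def)
    define S0 where "S0 = {(a :: int, b :: int). (a = 0 \<or> b = 0) \<and> \<bar>of_int a\<bar> \<le> X ^ 3 \<and> \<bar>of_int b\<bar> \<le> X ^ 4}"
    define S1 where "S1 = {(a :: int, b :: int). a \<noteq> 0 \<and> b \<noteq> 0 \<and> \<bar>of_int a\<bar> \<le> X ^ 3 \<and> \<bar>of_int b\<bar> \<le> X ^ 4 \<and>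
      (\<exists>d :: nat. real d > D \<and> int d dvd a \<and> int d dvd b)}"
    define S2 where "S2 = {(a :: int, b :: int). a \<noteq> 0 \<and> \<bar>of_int a\<bar> \<le> X ^ 3 \<and> \<bar>of_int b\<bar> \<le> X ^ 4 \<and>
      (\<exists>e :: nat. real e > D \<and> real e \<le> E \<and> squarefree e \<and> coprime (int e) (3 * \<alpha>) \<and> coprime (int e) b \<and>
         (int e)\<^sup>2 dvd \<beta> * a ^ 4 + \<alpha> * b ^ 3)}"
    define S3 where "S3 = {(a :: int, b :: int).
      \<bar>\<alpha> * \<beta> * b\<bar> \<le> Y ^ 4 \<and> \<bar>\<alpha> * \<beta>\<^sup>2 * a\<^sup>2\<bar> \<le> Y ^ 6 \<and>
      (\<forall>z. z ^ 3 + 3 * (\<alpha> * \<beta> * b) * z \<noteq> 2 * (\<alpha> * \<beta>\<^sup>2 * a\<^sup>2)) \<and>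
      (\<exists>e :: int. of_int e > E \<and> coprime e (\<alpha> * \<beta> * b) \<and>
         e\<^sup>2 dvd (\<alpha> * \<beta>\<^sup>2 * a\<^sup>2)\<^sup>2 + (\<alpha> * \<beta> * b) ^ 3)}"
    define S4 where "S4 = {(a :: int, b :: int). a \<noteq> 0 \<and> \<bar>of_int a\<bar> \<le> X ^ 3 \<and>
      \<bar>\<alpha> * \<beta> * b\<bar> \<le> Y ^ 4 \<and> \<bar>\<alpha> * \<beta>\<^sup>2 * a\<^sup>2\<bar> \<le> Y ^ 6 \<and>
      (\<exists>z. z ^ 3 + 3 * (\<alpha> * \<beta> * b) * z = 2 * (\<alpha> * \<beta>\<^sup>2 * a\<^sup>2))}"
    have sub: "divisible_pairs \<alpha> \<beta> M X \<subseteq> S0 \<union> S1 \<union> S2 \<union> S3 \<union> S4"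
    proof
      fix x assume "x \<in> divisible_pairs \<alpha> \<beta> M X"
      then obtain a b m where x: "x = (a, b)" and a: "\<bar>of_int a\<bar> \<le> X ^ 3" and b: "\<bar>of_int b\<bar> \<le> X ^ 4"
        and m: "squarefree m" "real m > M" "(int m)\<^sup>2 dvd \<beta> * a ^ 4 + \<alpha> * b ^ 3"
        unfolding divisible_pairs_def by blast
      show "x \<in> S0 \<union> S1 \<union> S2 \<union> S3 \<union> S4"
      proof (cases "a = 0 \<or> b = 0")
        case True
        thus ?thesis using x a b by (simp add: S0_def)
      next
        case False
        obtain d e :: nat where de: "squarefree e" "int d dvd a" "int d dvd b" "coprime (int e) (3 * \<alpha> * \<beta>)"
          "coprime (int e) b" "(int e)\<^sup>2 dvd \<beta> * a ^ 4 + \<alpha> * b ^ 3" "int m \<le> \<bar>3 * \<alpha> * \<beta>\<bar> * (int d * int e)"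
          using squarefree_square_divisor_split[OF nz m(1,3)] by metis
        have M_less: "M < 3 * of_int K * (real d * real e)"
        proof -
          have "int m \<le> 3 * K * (int d * int e)" using de(7) by (simp add: K_def abs_mult)
          hence "of_int (int m) \<le> (of_int (3 * K * (int d * int e)) :: real)" by (simp only: of_int_le_iff)
          thus ?thesis using m(2) by simp
        qed
        have "real d > D \<or> real e > D"
        proof (rule ccontr)
          assume "\<not> ?thesis"
          hence "real d * real e \<le> D * D" by (intro mult_mono) auto
          also have "D * D = M / (3 * of_int K)" using M K by (simp add: D_def q_def)
          finally show False using M_less K by (simp add: field_simps)
        qed
        then consider "real d > D" | "real e > D" "real e \<le> E" | "real e > E" by linarith
        thus ?thesis
        proof cases
          case 1
          thus ?thesis using x a b False de by (auto simp: S1_def)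
        next
          case 2
          have "coprime (int e) (3 * \<alpha>)" using de(4) by simp
          thus ?thesis using x a b False de 2 by (auto simp: S2_def)
        next
          case 3
          have bY: "\<bar>\<alpha> * \<beta> * b\<bar> \<le> Y ^ 4"
          proof -
            have "of_int \<bar>\<alpha> * \<beta> * b\<bar> \<le> of_int K * X ^ 4"
              using b K by (simp add: K_def abs_mult mult_left_mono)
            also have "\<dots> \<le> of_int K ^ 4 * X ^ 4"
              using K X self_le_power[of "of_int K :: real" 4] by (intro mult_right_mono) auto
            also have "\<dots> = (of_int K * X) ^ 4" by (simp add: power_mult_distrib)
            also have "\<dots> \<le> of_int Y ^ 4" using Ylow K X by (intro power_mono) auto
            finally show ?thesis by (simp only: of_int_power[symmetric] of_int_le_iff)
          qed
          have aY: "\<bar>\<alpha> * \<beta>\<^sup>2 * a\<^sup>2\<bar> \<le> Y ^ 6"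
          proof -
            have "of_int \<bar>\<alpha> * \<beta>\<^sup>2 * a\<^sup>2\<bar> = (of_int \<bar>\<alpha> * \<beta>\<^sup>2\<bar> * \<bar>of_int a\<bar> ^ 2 :: real)"
              by (simp add: abs_mult)
            also have "\<dots> \<le> of_int (K\<^sup>2) * (X ^ 3) ^ 2"
              using a K2 by (intro mult_mono power_mono) (auto simp only: of_int_le_iff abs_ge_zero of_int_0_le_iff zero_le_power2)
            also have "\<dots> \<le> of_int K ^ 6 * (X ^ 3) ^ 2"
              using K X power_increasing[of 2 6 "of_int K :: real"] by (intro mult_right_mono) auto
            also have "\<dots> = (of_int K * X) ^ 6" by (simp add: power_mult_distrib flip: power_mult)
            also have "\<dots> \<le> of_int Y ^ 6" using Ylow K X by (intro power_mono) auto
            finally show ?thesis by (simp only: of_int_power[symmetric] of_int_le_iff)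
          qed
          have cop: "coprime (int e) (\<alpha> * \<beta> * b)" using de(4,5) by simp
          have "(\<alpha> * \<beta>\<^sup>2 * a\<^sup>2)\<^sup>2 + (\<alpha> * \<beta> * b) ^ 3 = \<alpha>\<^sup>2 * \<beta> ^ 3 * (\<beta> * a ^ 4 + \<alpha> * b ^ 3)"
            by algebra
          hence dv: "(int e)\<^sup>2 dvd (\<alpha> * \<beta>\<^sup>2 * a\<^sup>2)\<^sup>2 + (\<alpha> * \<beta> * b) ^ 3" using de(6) by simp
          have eE: "of_int (int e) > E" using 3 by simp
          show ?thesis
          proof (cases "\<exists>z. z ^ 3 + 3 * (\<alpha> * \<beta> * b) * z = 2 * (\<alpha> * \<beta>\<^sup>2 * a\<^sup>2)")
            case True
            hence "x \<in> S4" using x a False bY aY unfolding S4_def by blast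
            thus ?thesis by blast
          next
            case no_root: False
            hence "x \<in> S3" using x bY aY cop dv eE unfolding S3_def by blast
            thus ?thesis by blast
          qed
        qed
      qed
    qed
    define T1 where "T1 = X powr (7 + \<eta>) / sqrt M"
    define T2 where "T2 = X powr 6.9"
    have T: "T1 \<ge> 0" "T2 \<ge> 0" using M by (auto simp: T1_def T2_def)
    have XT2: "X powr t \<le> T2" if "t \<le> 6.9" for t
      unfolding T2_def using X that by (intro powr_mono) auto
    have T1I: "X powr t / D \<le> q * T1" if "t \<le> 7 + \<eta>" for t
    proof -
      have "X powr t / D = q * (X powr t / sqrt M)" by (simp add: D_def)
      also have "\<dots> \<le> q * T1"
        unfolding T1_def using X M q that by (intro mult_left_mono divide_right_mono powr_mono) auto
      finally show ?thesis .
    qed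
    have X3: "X ^ 3 \<ge> 0" and X4: "X ^ 4 \<ge> 0" using X by auto
    have S0: "finite S0" "real (card S0) \<le> 6 * T2"
    proof -
      let ?A = "{a :: int. \<bar>of_int a\<bar> \<le> X ^ 3}" and ?B = "{b :: int. \<bar>of_int b\<bar> \<le> X ^ 4}"
      have sub0: "S0 \<subseteq> ?A \<times> {0} \<union> {0} \<times> ?B" by (auto simp: S0_def)
      have fin0: "finite (?A \<times> {0 :: int} \<union> {0 :: int} \<times> ?B)"
        using card_abs_le_bound(1)[OF X3] card_abs_le_bound(1)[OF X4] by simp
      show "finite S0" using sub0 fin0 by (rule finite_subset)
      have "card S0 \<le> card (?A \<times> {0 :: int} \<union> {0 :: int} \<times> ?B)" using fin0 sub0 by (rule card_mono)
      also have "\<dots> \<le> card (?A \<times> {0 :: int}) + card ({0 :: int} \<times> ?B)" by (rule card_Un_le)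
      finally have "real (card S0) \<le> (2 * X ^ 3 + 1) + (2 * X ^ 4 + 1)"
        using card_abs_le_bound(2)[OF X3] card_abs_le_bound(2)[OF X4] by (simp add: card_cartesian_product)
      also have "X ^ 3 \<le> X ^ 4" using X by (intro power_increasing) auto
      also have "(2 * X ^ 4 + 1) + (2 * X ^ 4 + 1) \<le> 6 * X ^ 4" using Xp[of 4] by simp
      also have "X ^ 4 = X powr 4" using X by simp
      also have "6 * X powr 4 \<le> 6 * T2" by (intro mult_left_mono XT2) auto
      finally show "real (card S0) \<le> 6 * T2" by simp
    qed
    have S1: "finite S1" "real (card S1) \<le> 8 * q * T1"
    proof -
      show "finite S1" unfolding S1_def by (rule card_common_divisor_pairs_le[OF X3 X4 D])
      have "real (card S1) \<le> 8 * X ^ 3 * X ^ 4 / D"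
        unfolding S1_def by (rule card_common_divisor_pairs_le[OF X3 X4 D])
      also have "\<dots> = 8 * (X powr 7 / D)" using X by (simp flip: power_add)
      also have "\<dots> \<le> 8 * (q * T1)" using \<eta> by (intro mult_left_mono T1I) auto
      finally show "real (card S1) \<le> 8 * q * T1" by simp
    qed
    have Eup: "E \<le> \<kappa> powr (7 / 2) * X powr (7 / 2)"
      using powr_mono2[of "7 / 2" "of_int Y" "\<kappa> * X"] Yup y1 \<kappa> X by (simp add: E_def powr_mult)
    have S2: "finite S2" "real (card S2) \<le> c2 * (4 * q) * T1 + c2 * (2 * \<kappa> powr (7 / 2)) * T2"
    proof -
      note bound = card_coprime_solutions_le[OF X3 X4 D \<delta> E0 C0(2), where \<alpha> = \<alpha> and \<beta> = \<beta>, folded S2_def]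
      show "finite S2" by (rule bound(1))
      have "C0 * E powr \<delta> \<le> C0 * (\<kappa> powr (7 / 2 * \<delta>) * X powr (7 / 2 * \<delta>))"
        using powr_mono2[OF _ E0 Eup, of \<delta>] \<delta> C0(1) by (simp add: powr_mult powr_powr)
      hence "(C0 * E powr \<delta>)\<^sup>2 \<le> (C0 * (\<kappa> powr (7 / 2 * \<delta>) * X powr (7 / 2 * \<delta>)))\<^sup>2"
        using C0(1) by (intro power_mono) auto
      also have "\<dots> = (C0 * \<kappa> powr (7 / 2 * \<delta>))\<^sup>2 * (X powr (7 / 2 * \<delta>) * X powr (7 / 2 * \<delta>))"
        by (simp add: power2_eq_square mult_ac)
      also have "X powr (7 / 2 * \<delta>) * X powr (7 / 2 * \<delta>) = X powr \<theta>"
        by (simp add: \<delta>_def flip: powr_add)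
      finally have H: "2 * (C0 * E powr \<delta>)\<^sup>2 \<le> c2 * X powr \<theta>" by (simp add: c2_def)
      have "real (card S2) \<le> X ^ 3 * (2 * (C0 * E powr \<delta>)\<^sup>2) * (4 * X ^ 4 / D + 2 * E)"
        using bound(2) by (simp add: mult_ac)
      also have "\<dots> \<le> X ^ 3 * (c2 * X powr \<theta>) * (4 * X ^ 4 / D + 2 * (\<kappa> powr (7 / 2) * X powr (7 / 2)))"
        using Eup X3 X4 D E0 \<open>c2 \<ge> 0\<close> by (intro mult_mono[OF mult_left_mono[OF H X3]]) auto
      also have "\<dots> = c2 * 4 * ((X ^ 3 * X ^ 4 * X powr \<theta>) / D) +
          c2 * (2 * \<kappa> powr (7 / 2)) * (X ^ 3 * X powr \<theta> * X powr (7 / 2))"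
        by (simp add: algebra_simps)
      also have "X ^ 3 * X ^ 4 * X powr \<theta> = X powr (7 + \<theta>)"
        using X by (simp add: powr_add flip: power_add)
      also have "X ^ 3 * X powr \<theta> * X powr (7 / 2) = X powr 3 * X powr \<theta> * X powr (7 / 2)"
        using X by simp
      also have "\<dots> = X powr (3 + \<theta> + 7 / 2)" by (simp only: powr_add)
      also have "c2 * 4 * (X powr (7 + \<theta>) / D) + c2 * (2 * \<kappa> powr (7 / 2)) * X powr (3 + \<theta> + 7 / 2)
          \<le> c2 * 4 * (q * T1) + c2 * (2 * \<kappa> powr (7 / 2)) * T2"
        using \<open>c2 \<ge> 0\<close> \<theta> by (intro add_mono mult_left_mono T1I XT2) auto
      finally show "real (card S2) \<le> c2 * (4 * q) * T1 + c2 * (2 * \<kappa> powr (7 / 2)) * T2"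
        by (simp add: mult_ac)
    qed
    have S3: "finite S3" "real (card S3) \<le> c3 * T2"
    proof -
      note bound = card_large_conductor_pairs_le[OF nz Y1 E _ Z, folded S3_def, simplified]
      show "finite S3" by (rule bound(1))
      have "of_int Y ^ 10 = of_int Y powr (13 / 2) * E"
        using y1 by (simp add: E_def flip: powr_add)
      hence "165888 * of_int Y ^ 10 / E = 165888 * of_int Y powr (13 / 2)"
        using y1 by (simp add: E_def)
      also have "\<dots> \<le> 165888 * (\<kappa> * X) powr (13 / 2)"
        using Yup y1 by (intro mult_left_mono powr_mono2) auto
      finally have "(165888 * of_int Y ^ 10 / E) powr (21 / 20) \<le> (165888 * (\<kappa> * X) powr (13 / 2)) powr (21 / 20)"
        using y1 E0 by (intro powr_mono2) auto
      also have "\<dots> = (165888 * \<kappa> powr (13 / 2)) powr (21 / 20) * X powr (273 / 40)"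
        using \<kappa> X by (simp add: powr_mult powr_powr)
      also have "\<dots> \<le> (165888 * \<kappa> powr (13 / 2)) powr (21 / 20) * T2"
        by (intro mult_left_mono XT2) auto
      finally have "2 * (Z ^ 6 * (165888 * of_int Y ^ 10 / E) powr (21 / 20)) \<le>
          2 * (Z ^ 6 * ((165888 * \<kappa> powr (13 / 2)) powr (21 / 20) * T2))"
        using \<open>Z \<ge> 0\<close> by (intro mult_left_mono) auto
      thus "real (card S3) \<le> c3 * T2" using bound(2) by (simp add: c3_def mult_ac)
    qed
    have S4: "finite S4" "real (card S4) \<le> 15 * \<kappa>\<^sup>2 * T2"
    proof -
      note bound = card_integer_root_pairs_le[OF nz X3 Y1, folded S4_def]
      show "finite S4" by (rule bound(1))
      note bound(2)
      also have "(2 * X ^ 3 + 1) * (5 * of_int Y ^ 2) \<le> (3 * X ^ 3) * (5 * (\<kappa> * X) ^ 2)"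
        using Xp[of 3] Yup y1 X by (intro mult_mono power_mono) auto
      also have "\<dots> = 15 * \<kappa>\<^sup>2 * X powr 5"
        using X by (simp add: power_mult_distrib power_numeral_reduce)
      also have "\<dots> \<le> 15 * \<kappa>\<^sup>2 * T2" by (intro mult_left_mono XT2) auto
      finally show "real (card S4) \<le> 15 * \<kappa>\<^sup>2 * T2" .
    qed
    have fin: "finite (S0 \<union> S1 \<union> S2 \<union> S3 \<union> S4)" using S0 S1 S2 S3 S4 by simp
    have "card (divisible_pairs \<alpha> \<beta> M X) \<le> card (S0 \<union> S1 \<union> S2 \<union> S3 \<union> S4)"
      using fin sub by (rule card_mono)
    also have "\<dots> \<le> card S0 + card S1 + card S2 + card S3 + card S4"
      by (meson add_le_mono card_Un_le le_refl order_trans)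
    finally have "real (card (divisible_pairs \<alpha> \<beta> M X)) \<le>
      6 * T2 + 8 * q * T1 + (c2 * (4 * q) * T1 + c2 * (2 * \<kappa> powr (7 / 2)) * T2) + c3 * T2 + 15 * \<kappa>\<^sup>2 * T2"
      using S0(2) S1(2) S2(2) S3(2) S4(2) by linarith
    also have "\<dots> \<le> C * (T1 + T2)"
    proof -
      have "(8 * q + c2 * (4 * q)) * T1 \<le> C * T1" "(6 + c2 * (2 * \<kappa> powr (7 / 2)) + c3 + 15 * \<kappa>\<^sup>2) * T2 \<le> C * T2"
        using T q \<open>c2 \<ge> 0\<close> \<open>c3 \<ge> 0\<close> by (auto intro!: mult_right_mono simp: C_def)
      thus ?thesis by (simp add: algebra_simps)
    qed
    finally show ?thesis using finite_subset[OF sub fin] by (simp add: T1_def T2_def)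
  qed
  ultimately show thesis by (rule that)
qed

section \<open>Summation over the square divisors\<close>

text \<open>After exchanging sums, a finite partial sum counts each pair in
  \<open>divisible_pairs\<close> once for every \<open>m\<close> that occurs, and such
  \<open>m\<close> are squarefree divisors of a nonzero integer of polynomial size. One half of
  \<open>\<epsilon>\<close> pays for the number of pairs, the other half for these divisors.\<close>

theorem theorem1p3:
  fixes \<alpha> \<beta> :: int and \<epsilon> :: real
  assumes "\<alpha> \<noteq> 0" and "\<beta> \<noteq> 0" and "squarefree (gcd \<alpha> \<beta>)" and "\<epsilon> > 0"
  shows "\<exists>C\<^sub>1 C\<^sub>2 :: real. \<forall>M X :: real. M > 0 \<longrightarrow> X > 0 \<longrightarrow>
           (\<lambda>m. real (N_count m X \<alpha> \<beta>)) summable_on {m :: nat. squarefree m \<and> real m > M} \<and>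
           (\<Sum>\<^sub>\<infinity>m\<in>{m :: nat. squarefree m \<and> real m > M}. real (N_count m X \<alpha> \<beta>))
             \<le> C\<^sub>1 * (X powr (7 + \<epsilon>) / sqrt M) + C\<^sub>2 * X powr (6.992 + \<epsilon>)"
proof -
  \<comment> \<open>The integers to be divided are at most \<open>k * X ^ 12\<close>, and
    \<open>(X ^ 12) powr \<delta>\<close> is \<open>X powr (\<epsilon> / 2)\<close>.\<close>
  define \<delta> where "\<delta> = \<epsilon> / 24"
  have \<delta>: "\<delta> > 0" using assms(4) by (simp add: \<delta>_def)
  obtain C where C: "C \<ge> 0"
    "\<And>M X. M > 0 \<Longrightarrow> X \<ge> 1 \<Longrightarrow> finite (divisible_pairs \<alpha> \<beta> M X) \<and>
       real (card (divisible_pairs \<alpha> \<beta> M X)) \<le> C * (X powr (7 + \<epsilon> / 2) / sqrt M + X powr 6.9)"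
    using card_divisible_pairs_le[OF assms(1,2), of "\<epsilon> / 2"] assms(4) by (metis half_gt_zero)
  obtain C' where C': "C' > 0"
    "\<And>n :: nat. n > 0 \<Longrightarrow> real (card {d. squarefree d \<and> d dvd n}) \<le> C' * real n powr \<delta>"
    using card_squarefree_divisors_le[OF \<delta>] by metis
  define k :: real where "k = \<bar>of_int \<beta>\<bar> + \<bar>of_int \<alpha>\<bar>"
  have k: "k \<ge> 0" by (simp add: k_def)
  define G where "G = C * (C' * k powr \<delta>)"
  have G: "G \<ge> 0" using C(1) C'(1) by (simp add: G_def)
  have partial: "(\<Sum>m\<in>F. real (N_count m X \<alpha> \<beta>)) \<le> G * (X powr (7 + \<epsilon>) / sqrt M) + G * X powr (6.992 + \<epsilon>)"
    if M: "M > 0" and X: "X > 0" and F: "finite F" "F \<subseteq> {m. squarefree m \<and> real m > M}" for M X F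
  proof (cases "X \<ge> 1")
    case False
    \<comment> \<open>The box then contains only the pair \<open>(0, 0)\<close>, which
      \<open>N_count\<close> leaves out.\<close>
    hence small: "X ^ 3 < 1" "X ^ 4 < 1" using X by (simp_all add: power_less_one_iff)
    have zero: "a = 0" if "\<bar>of_int a\<bar> \<le> X ^ 3 \<or> \<bar>of_int a\<bar> \<le> X ^ 4" for a :: int
    proof -
      have "\<bar>of_int a\<bar> < (1 :: real)" using that small by linarith
      thus ?thesis by linarith
    qed
    have "\<beta> * a ^ 4 + \<alpha> * b ^ 3 = 0" if "\<bar>of_int a\<bar> \<le> X ^ 3" "\<bar>of_int b\<bar> \<le> X ^ 4" for a b :: int
      using zero[of a] zero[of b] that by simp
    note vanish = this
    have "N_count m X \<alpha> \<beta> = 0" for m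
    proof -
      have "{(a :: int, b :: int). \<bar>of_int a\<bar> \<le> X ^ 3 \<and> \<bar>of_int b\<bar> \<le> X ^ 4 \<and>
             \<beta> * a ^ 4 + \<alpha> * b ^ 3 \<noteq> 0 \<and> (int m)\<^sup>2 dvd \<beta> * a ^ 4 + \<alpha> * b ^ 3} = {}"
        using vanish by blast
      thus ?thesis unfolding N_count_def by (simp only: card.empty)
    qed
    thus ?thesis using G M by simp
  next
    case True
    define S where "S = divisible_pairs \<alpha> \<beta> M X"
    define n where "n = (\<lambda>x. \<beta> * fst x ^ 4 + \<alpha> * snd x ^ 3)"
    define V where "V = (\<lambda>x. {m \<in> F. (int m)\<^sup>2 dvd n x})"
    have S: "finite S" "real (card S) \<le> C * (X powr (7 + \<epsilon> / 2) / sqrt M + X powr 6.9)"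
      using C(2)[OF M True] by (auto simp: S_def)
    \<comment> \<open>Here \<open>m\<close> itself witnesses that each counted pair belongs to
      \<open>S\<close>.\<close>
    have N: "N_count m X \<alpha> \<beta> = card {x \<in> S. (int m)\<^sup>2 dvd n x}" if "m \<in> F" for m
    proof -
      have "squarefree m" "real m > M" using that F(2) by auto
      hence "{(a :: int, b :: int). \<bar>of_int a\<bar> \<le> X ^ 3 \<and> \<bar>of_int b\<bar> \<le> X ^ 4 \<and>
             \<beta> * a ^ 4 + \<alpha> * b ^ 3 \<noteq> 0 \<and> (int m)\<^sup>2 dvd \<beta> * a ^ 4 + \<alpha> * b ^ 3} = {x \<in> S. (int m)\<^sup>2 dvd n x}"
        unfolding S_def divisible_pairs_def n_def by auto
      thus ?thesis unfolding N_count_def by (rule arg_cong)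
    qed
    have V: "real (card (V x)) \<le> C' * k powr \<delta> * X powr (\<epsilon> / 2)" if x: "x \<in> S" for x
    proof -
      obtain a b where ab: "x = (a, b)" "\<bar>of_int a\<bar> \<le> X ^ 3" "\<bar>of_int b\<bar> \<le> X ^ 4" "n x \<noteq> 0"
        using x by (auto simp: S_def divisible_pairs_def n_def)
      define u where "u = nat \<bar>n x\<bar>"
      have u: "u > 0" "real u = \<bar>of_int (n x)\<bar>" using ab(4) by (auto simp: u_def)
      have "V x \<subseteq> {d. squarefree d \<and> d dvd u}"
      proof
        fix m assume m: "m \<in> V x"
        hence "int m dvd n x" by (auto simp: V_def intro: dvd_trans[OF dvd_power])
        hence "int m dvd int u" by (simp add: u_def)
        thus "m \<in> {d. squarefree d \<and> d dvd u}" using m F(2) by (auto simp: V_def)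
      qed
      hence "card (V x) \<le> card {d. squarefree d \<and> d dvd u}"
        using u(1) by (intro card_mono finite_subset[OF _ finite_divisors_nat[of u]]) auto
      hence "real (card (V x)) \<le> C' * real u powr \<delta>" using C'(2)[OF u(1)] by linarith
      also have "\<dots> \<le> C' * (k * X ^ 12) powr \<delta>"
      proof (intro mult_left_mono powr_mono2)
        have "real u \<le> \<bar>of_int \<beta>\<bar> * \<bar>of_int a\<bar> ^ 4 + \<bar>of_int \<alpha>\<bar> * \<bar>of_int b\<bar> ^ 3"
          unfolding u(2) n_def ab(1) fst_conv snd_conv of_int_add of_int_mult of_int_power
          by (rule order_trans[OF abs_triangle_ineq]) (simp add: abs_mult power_abs)
        also have "\<dots> \<le> \<bar>of_int \<beta>\<bar> * (X ^ 3) ^ 4 + \<bar>of_int \<alpha>\<bar> * (X ^ 4) ^ 3"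
          using ab by (intro add_mono mult_left_mono power_mono) auto
        also have "\<dots> = k * X ^ 12" by (simp add: k_def algebra_simps flip: power_mult)
        finally show "real u \<le> k * X ^ 12" .
      qed (use \<delta> C'(1) in auto)
      also have "(k * X ^ 12) powr \<delta> = k powr \<delta> * X powr (\<epsilon> / 2)"
        using k X by (simp add: powr_mult powr_powr \<delta>_def flip: powr_numeral)
      finally show ?thesis by (simp add: mult_ac)
    qed
    have "(\<Sum>m\<in>F. real (N_count m X \<alpha> \<beta>)) = (\<Sum>m\<in>F. \<Sum>x\<in>S. if (int m)\<^sup>2 dvd n x then 1 else 0)"
      using S(1) by (intro sum.cong) (auto simp: N sum.If_cases Int_def)
    also have "\<dots> = (\<Sum>x\<in>S. \<Sum>m\<in>F. if (int m)\<^sup>2 dvd n x then 1 else 0)" by (rule sum.swap)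
    also have "\<dots> = (\<Sum>x\<in>S. real (card (V x)))"
      using F(1) by (intro sum.cong) (auto simp: V_def sum.If_cases Int_def)
    also have "\<dots> \<le> (\<Sum>x\<in>S. C' * k powr \<delta> * X powr (\<epsilon> / 2))" using V by (rule sum_mono)
    also have "\<dots> = real (card S) * (C' * k powr \<delta> * X powr (\<epsilon> / 2))" by simp
    also have "\<dots> \<le> C * (X powr (7 + \<epsilon> / 2) / sqrt M + X powr 6.9) * (C' * k powr \<delta> * X powr (\<epsilon> / 2))"
      using S(2) C'(1) by (intro mult_right_mono) auto
    also have "\<dots> = G * (X powr (7 + \<epsilon> / 2) * X powr (\<epsilon> / 2) / sqrt M) + G * (X powr 6.9 * X powr (\<epsilon> / 2))"
      by (simp add: G_def algebra_simps)
    also have "X powr (7 + \<epsilon> / 2) * X powr (\<epsilon> / 2) = X powr (7 + \<epsilon>)" by (simp add: add.commute flip: powr_add)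
    also have "X powr 6.9 * X powr (\<epsilon> / 2) \<le> X powr (6.992 + \<epsilon>)"
      unfolding powr_add[symmetric] using True assms(4) by (intro powr_mono) auto
    finally show ?thesis using G by (simp add: mult_left_mono)
  qed
  show ?thesis
  proof (intro exI allI impI conjI)
    fix M X :: real assume MX: "M > 0" "X > 0"
    \<comment> \<open>The terms are nonnegative and the finite partial sums are uniformly bounded,
      which gives convergence as well as the bound for the infinite sum.\<close>
    show summable: "(\<lambda>m. real (N_count m X \<alpha> \<beta>)) summable_on {m :: nat. squarefree m \<and> real m > M}"
      using partial[OF MX] by (intro nonneg_bdd_above_summable_on) (auto intro!: bdd_aboveI2)
    show "(\<Sum>\<^sub>\<infinity>m\<in>{m :: nat. squarefree m \<and> real m > M}. real (N_count m X \<alpha> \<beta>))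
        \<le> G * (X powr (7 + \<epsilon>) / sqrt M) + G * X powr (6.992 + \<epsilon>)"
      by (rule infsum_le_finite_sums[OF summable partial[OF MX]])
  qed
qed

end
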